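(* For every planar graph $G$ with $n$ vertices, $$\pi(G)\leq 8\left(1+\log_{3/2} n\right).$$
   Context: Graphs are finite, simple, undirected and nonempty. A $k$-colouring of a graph $G$ is a function $\psi$ assigning one of $k$ colours to each vertex of $G$ (not required to be proper). A path $(v_1,v_2,\dots,v_{2t})$ in $G$ with $t\geq 1$ (the vertices are distinct and consecutive vertices are adjacent; it need not be induced) is repetitively coloured by $\psi$ if $\psi(v_i)=\psi(v_{t+i})$ for all $i\in\{1,2,\dots,t\}$. A colouring $\psi$ of $G$ is nonrepetitive if no path of $G$ is repetitively coloured by $\psi$. The nonrepetitive chromatic number $\pi(G)$ is the minimum integer $k$ such that $G$ admits a nonrepetitive $k$-colouring. *)

theory Defs
  imports
    "HOL-Analysis.Analysis"
    "Graph_Theory.Pair_Digraph"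
    "Graph_Theory.Vertex_Walk"
begin

text \<open>
  A finite simple undirected graph is a \<^locale>\<open>pair_graph\<close>: each undirected edge
  \<open>{u, v}\<close> is represented by the two arcs \<open>(u, v)\<close> and \<open>(v, u)\<close>.
  A path \<open>(v\<^sub>1, \<dots>, v\<^sub>n)\<close> is a vertex list satisfying \<^const>\<open>vpath\<close>;
  in particular it is nonempty and need not be induced.
\<close>

subsection \<open>Planarity\<close>

text \<open>
  Vertices are drawn as distinct points of the plane (identified with the complex numbers) and
  each edge as an arc, i.e. an injective continuous image of the unit interval, joining its two
  ends.  The curve is indexed by the two-element set \<open>{u, v}\<close>, so that both arcs
  representing an undirected edge share one curve, whose orientation is irrelevant.
\<close>

definition plane_drawing ::
  "'a pair_pre_digraph \<Rightarrow> ('a \<Rightarrow> complex) \<Rightarrow> ('a set \<Rightarrow> real \<Rightarrow> complex) \<Rightarrow> bool" where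
  "plane_drawing G p \<gamma> \<longleftrightarrow>
     inj_on p (pverts G) \<and>
     (\<forall>u v. (u, v) \<in> parcs G \<longrightarrow>
        arc (\<gamma> {u, v}) \<and>
        {pathstart (\<gamma> {u, v}), pathfinish (\<gamma> {u, v})} = {p u, p v} \<and>
        path_image (\<gamma> {u, v}) \<inter> p ` pverts G = {p u, p v}) \<and>
     (\<forall>u v x y. (u, v) \<in> parcs G \<and> (x, y) \<in> parcs G \<and> {u, v} \<noteq> {x, y} \<longrightarrow>
        path_image (\<gamma> {u, v}) \<inter> path_image (\<gamma> {x, y}) \<subseteq> p ` ({u, v} \<inter> {x, y}))"

definition planar_graph :: "'a pair_pre_digraph \<Rightarrow> bool" where
  "planar_graph G \<longleftrightarrow> (\<exists>p \<gamma>. plane_drawing G p \<gamma>)"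

subsection \<open>Nonrepetitive colourings\<close>

definition k_colouring :: "'a pair_pre_digraph \<Rightarrow> nat \<Rightarrow> ('a \<Rightarrow> nat) \<Rightarrow> bool" where
  "k_colouring G k \<psi> \<longleftrightarrow> \<psi> ` pverts G \<subseteq> {..<k}"

definition repetitively_coloured :: "('a \<Rightarrow> nat) \<Rightarrow> 'a list \<Rightarrow> bool" where
  "repetitively_coloured \<psi> vs \<longleftrightarrow>
     (\<exists>t\<ge>1. length vs = 2 * t \<and> (\<forall>i<t. \<psi> (vs ! i) = \<psi> (vs ! (t + i))))"

definition nonrepetitive :: "'a pair_pre_digraph \<Rightarrow> ('a \<Rightarrow> nat) \<Rightarrow> bool" where
  "nonrepetitive G \<psi> \<longleftrightarrow>
     (\<forall>vs. vpath vs (with_proj G) \<longrightarrow> \<not> repetitively_coloured \<psi> vs)"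

definition nonrep_chromatic_number :: "'a pair_pre_digraph \<Rightarrow> nat" where
  "nonrep_chromatic_number G =
     (LEAST k. \<exists>\<psi>. k_colouring G k \<psi> \<and> nonrepetitive G \<psi>)"

text \<open>The minimum is taken over a nonempty set: an injective colouring is nonrepetitive.\<close>

lemma nonrepetitive_colouring_exists:
  assumes "finite (pverts G)"
  shows "\<exists>\<psi>. k_colouring G (card (pverts G)) \<psi> \<and> nonrepetitive G \<psi>"
proof -
  obtain \<psi> where \<psi>: "bij_betw \<psi> (pverts G) {0..<card (pverts G)}"
    using ex_bij_betw_finite_nat[OF assms] by blast
  have "k_colouring G (card (pverts G)) \<psi>"
    using \<psi> by (auto simp: k_colouring_def bij_betw_def)
  moreover have "\<not> repetitively_coloured \<psi> vs" if "vpath vs (with_proj G)" for vs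
  proof
    assume "repetitively_coloured \<psi> vs"
    then obtain t where t: "t \<ge> 1" "length vs = 2 * t" "\<psi> (vs ! 0) = \<psi> (vs ! t)"
      unfolding repetitively_coloured_def by force
    have "set vs \<subseteq> pverts G" "distinct vs"
      using that by (auto simp: vpath_def vwalk_def)
    moreover have "vs ! 0 \<in> set vs" "vs ! t \<in> set vs"
      using t by auto
    ultimately have "vs ! 0 = vs ! t"
      using \<psi> t(3) by (auto simp: bij_betw_def dest: inj_onD)
    then show False
      using \<open>distinct vs\<close> t by (simp add: nth_eq_iff_index_eq)
  qed
  ultimately show ?thesis
    by (auto simp: nonrepetitive_def)
qed

end

theory Submission
  imports Defs
begin

text \<open>
  The colour of a vertex records three things: a colour from \<open>{0, 1, 2, 3}\<close> of its layer, the level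
  at which it is removed by a recursive balanced separation of the graph, and one bit.  The layers
  are numbered so that the ends of an edge lie in equal or consecutive layers, and every separator
  contains at most two vertices of each layer, which the bit tells apart.  As each
  separation leaves parts with at most two thirds of the vertices, there are at most
  \<open>1 + log (3/2) n\<close> levels, and eight colours per level.

  Why this colouring is nonrepetitive: along a path the layers form a walk on the path
  \<open>0, 1, 2, \<dots>\<close> which may also stand still.  The layers are coloured by a square-free word without
  factors of the form \<open>aba\<close>, and for such a word two equally coloured halves of a walk visit
  the same layers at the same times (\<open>repetitive_lazy_walk\<close>).  A vertex of minimal level on a
  repetitively coloured path and its partner in the other half then agree in layer, level and
  bit.  No separator of a smaller level meets the path, so both lie in the same separator of their
  level; hence they are equal, although the vertices of a path are distinct.

  Why such separators exist: a fine square grid is laid over a drawing of the graph, and its cells,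
  which form a triangulated square, are labelled by vertices so that the cells of one label are
  connected and adjacent vertices have touching regions
  (\<open>planar_graph_grid_labelling\<close>).  The boundary of the square gets a label of its own, and the
  distance from it in the contact graph of the labels is the layering.  From
  every cell there is a route to a corner that meets at most one label of each layer, and the routes
  from two adjacent cells form a closed curve.  If each of these
  curves had more than two thirds of the vertices on one side, then "the heavy side is the inside" would
  be a relation on grid edges which, on each triangle, holds for an even number of edges,
  because three sets of more than two thirds of the vertices have a common element.  Summing over all
  triangles, as in the proof of Sperner's lemma, it would hold for an even
  number of boundary edges; but the routes along the boundary can be chosen so that it holds for
  exactly one of them (\<open>balanced_route_pair\<close>).  This parity argument takes the place of the
  Lipton--Tarjan argument on a triangulation of the graph, so that no faces, no rotation systems and no
  Jordan curve theorem enter.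
\<close>

section \<open>Words and repetitive walks on a path\<close>

fun thue_morse :: "nat \<Rightarrow> bool" where
  "thue_morse n = (if n = 0 then False else (thue_morse (n div 2) \<noteq> odd n))"

declare thue_morse.simps [simp del]

lemma thue_morse_double: "thue_morse (2 * n) = thue_morse n"
  by (cases "n = 0") (simp, subst thue_morse.simps, simp)

lemma thue_morse_double_Suc: "thue_morse (Suc (2 * n)) = (\<not> thue_morse n)"
  by (subst thue_morse.simps) simp

text \<open>Of two consecutive pairs of neighbouring positions, one is of the form \<open>2m, 2m + 1\<close>.\<close>
lemma thue_morse_no_cube: "\<not> (thue_morse i = thue_morse (i + 1) \<and> thue_morse (i + 1) = thue_morse (i + 2))"
proof (cases "even i")
  case True
  then obtain m where "i = 2 * m" by (elim evenE)
  then show ?thesis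
    using thue_morse_double[of m] thue_morse_double_Suc[of m] by simp
next
  case False
  then obtain m where "i = 2 * m + 1" by (elim oddE)
  then have "i + 1 = 2 * (m + 1)" "i + 2 = Suc (2 * (m + 1))" by auto
  then show ?thesis
    using thue_morse_double[of "m + 1"] thue_morse_double_Suc[of "m + 1"] by metis
qed

text \<open>
  Thue's theorem.  An even period is halved, since the letters at the even (or at the odd)
  positions form the same word again, up to complement.  An odd period larger than one
  moves pairs \<open>2m, 2m + 1\<close>, whose letters differ, onto pairs that straddle such blocks; this
  makes consecutive letters of the halved word equal, twice in a row.
\<close>
theorem thue_morse_overlap_free:
  assumes "p \<ge> 1"
  shows "\<exists>k\<le>p. thue_morse (i + k) \<noteq> thue_morse (i + k + p)"
  using assms
proof (induction p arbitrary: i rule: less_induct)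
  case (less p)
  show ?case
  proof (rule ccontr)
    assume "\<not> ?thesis"
    then have per: "thue_morse (i + k) = thue_morse (i + k + p)" if "k \<le> p" for k
      using that by blast
    show False
    proof (cases "even p")
      case True
      then obtain q where q: "p = 2 * q" by (elim evenE)
      have "thue_morse (i div 2 + l) = thue_morse (i div 2 + l + q)" if "l \<le> q" for l
      proof (cases "even i")
        case True
        then obtain m where "i = 2 * m" by (elim evenE)
        then show ?thesis
          using per[of "2 * l"] that q thue_morse_double[of "m + l"] thue_morse_double[of "m + l + q"]
          by (simp add: algebra_simps)
      next
        case False
        then obtain m where "i = 2 * m + 1" by (elim oddE)
        then show ?thesis
          using per[of "2 * l"] that q thue_morse_double_Suc[of "m + l"]
            thue_morse_double_Suc[of "m + l + q"]
          by (simp add: algebra_simps)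
      qed
      then show False
        using less.IH[of q "i div 2"] q less.prems by auto
    next
      case False
      have eq: "thue_morse ((j + p + 1) div 2) = thue_morse ((j + p + 1) div 2 - 1)"
        if j: "even j" "i \<le> j" "j < i + p" for j
      proof -
        obtain m where m: "j = 2 * m" using j(1) by (elim evenE)
        obtain r where r: "p = 2 * r + 1" using False by (elim oddE)
        have "thue_morse (2 * m) = thue_morse (Suc (2 * (m + r)))"
          "thue_morse (Suc (2 * m)) = thue_morse (2 * (m + r + 1))"
          using per[of "j - i"] per[of "j + 1 - i"] j m r by (auto simp: algebra_simps)
        then show ?thesis
          unfolding thue_morse_double thue_morse_double_Suc using m r by auto
      qed
      have eq': "thue_morse ((j + 1) div 2) = thue_morse ((j + 1) div 2 - 1)"
        if j: "odd j" "i \<le> j" "j < i + p" for j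
      proof -
        obtain m where m: "j = 2 * m + 1" using j(1) by (elim oddE)
        obtain r where r: "p = 2 * r + 1" using False by (elim oddE)
        have "thue_morse (Suc (2 * m)) = thue_morse (2 * (m + r + 1))"
          "thue_morse (2 * (m + 1)) = thue_morse (Suc (2 * (m + r + 1)))"
          using per[of "j - i"] per[of "j + 1 - i"] j m r by (auto simp: algebra_simps)
        then show ?thesis
          unfolding thue_morse_double thue_morse_double_Suc using m r by auto
      qed
      show False
      proof (cases "p = 1")
        case True
        then show False
          using per[of 0] per[of 1] thue_morse_no_cube[of i] by (simp add: numeral_2_eq_2)
      next
        case False
        then have p3: "p \<ge> 3" using \<open>odd p\<close> less.prems by presburger
        show False
        proof (cases "odd i")
          case True
          then obtain m where m: "i = 2 * m + 1" by (elim oddE)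
          have "(i + 1) div 2 = m + 1" "(i + 2 + 1) div 2 = m + 2" using m by auto
          then show False
            using eq'[of i] eq'[of "i + 2"] True p3 thue_morse_no_cube[of m] by auto
        next
          case False
          then obtain m where m: "i = 2 * m" by (auto elim: evenE)
          obtain r where r: "p = 2 * r + 1" using \<open>odd p\<close> by (elim oddE)
          have "(i + p + 1) div 2 = m + r + 1" "(i + 2 + p + 1) div 2 = m + r + 2" using m r by auto
          then show False
            using eq[of i] eq[of "i + 2"] False p3 thue_morse_no_cube[of "m + r"] by auto
        qed
      qed
    qed
  qed
qed

text \<open>
  The differences of an overlap-free binary word are square-free: summing over the two halves
  of a square shows that the binary word changes by \<open>s\<close> twice, thus by \<open>2s\<close> in total.  As binary
  letters differ by at most one, \<open>s = 0\<close>, and the binary word would contain an overlap.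
\<close>
definition ternary :: "nat \<Rightarrow> int" where
  "ternary n = of_bool (thue_morse (n + 1)) - of_bool (thue_morse n)"

lemma ternary_squarefree:
  assumes "p \<ge> 1"
  shows "\<exists>k<p. ternary (i + k) \<noteq> ternary (i + k + p)"
proof (rule ccontr)
  assume "\<not> ?thesis"
  then have sq: "ternary (i + k) = ternary (i + k + p)" if "k < p" for k using that by blast
  have sum: "(\<Sum>k<m. ternary (j + k)) = of_bool (thue_morse (j + m)) - of_bool (thue_morse j)" for j m
    by (induction m) (auto simp: ternary_def)
  have "(\<Sum>k<m. ternary (i + k)) = (\<Sum>k<m. ternary (i + p + k))" if "m \<le> p" for m
    by (rule sum.cong) (use sq that in \<open>auto simp: add_ac\<close>)
  then have diff: "of_bool (thue_morse (i + m)) - of_bool (thue_morse i) =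
      (of_bool (thue_morse (i + p + m)) - of_bool (thue_morse (i + p)) :: int)" if "m \<le> p" for m
    using that by (simp add: sum)
  have "thue_morse i = thue_morse (i + p)"
    using diff[of p] by (auto simp: of_bool_def split: if_splits)
  then have "thue_morse (i + m) = thue_morse (i + m + p)" if "m \<le> p" for m
    using diff[OF that] by (auto simp: of_bool_def add_ac split: if_splits)
  then show False using thue_morse_overlap_free[OF assms, of i] by blast
qed

text \<open>
  A square-free ternary word with a fourth letter inserted after every second letter.  The new
  letter destroys all factors \<open>aba\<close>, and deleting it from a square would leave a square.
\<close>
definition path_colour :: "nat \<Rightarrow> nat" where
  "path_colour n = (if n mod 3 = 2 then 3 else nat (ternary (2 * (n div 3) + n mod 3) + 1))"

lemma path_colour_less: "path_colour n < 4"
  by (auto simp: path_colour_def ternary_def)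

lemma ternary_ge: "ternary n + 1 \<ge> 0" "ternary n + 1 \<le> 2"
  by (auto simp: ternary_def)

lemma ternary_Suc: "ternary n \<noteq> ternary (Suc n)"
  using ternary_squarefree[of 1 n] by auto

lemma path_colour_near:
  "path_colour n \<noteq> path_colour (n + 1)" "path_colour n \<noteq> path_colour (n + 2)"
proof -
  obtain a b where ab: "n = 3 * a + b" "b < 3"
    by (metis mod_less_divisor mult_div_mod_eq zero_less_numeral)
  then have "b = 0 \<or> b = 1 \<or> b = 2" by auto
  then have "path_colour n \<noteq> path_colour (n + 1) \<and> path_colour n \<noteq> path_colour (n + 2)"
  proof (elim disjE)
    assume "b = 0"
    then have "n mod 3 = 0" "(n + 1) mod 3 = 1" "(n + 2) mod 3 = 2" "n div 3 = a" "(n + 1) div 3 = a"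
      using ab by presburger+
    then show ?thesis
      using ternary_ge[of "2 * a"] ternary_ge[of "2 * a + 1"] ternary_Suc[of "2 * a"]
      by (auto simp: path_colour_def nat_eq_iff nat_eq_iff2)
  next
    assume "b = 1"
    then have "n mod 3 = 1" "(n + 1) mod 3 = 2" "(n + 2) mod 3 = 0" "n div 3 = a" "(n + 2) div 3 = a + 1"
      using ab by presburger+
    then show ?thesis
      using ternary_ge[of "2 * a + 1"] ternary_ge[of "2 * a + 2"] ternary_Suc[of "2 * a + 1"]
      by (auto simp: path_colour_def nat_eq_iff nat_eq_iff2)
  next
    assume "b = 2"
    then have "n mod 3 = 2" "(n + 1) mod 3 = 0" "(n + 2) mod 3 = 1"
      using ab by presburger+
    then show ?thesis
      using ternary_ge[of "2 * ((n + 1) div 3)"] ternary_ge[of "2 * ((n + 2) div 3) + 1"]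
      by (auto simp: path_colour_def nat_eq_iff nat_eq_iff2)
  qed
  then show "path_colour n \<noteq> path_colour (n + 1)" "path_colour n \<noteq> path_colour (n + 2)" by auto
qed

lemma path_colour_squarefree:
  assumes "p \<ge> 1"
  shows "\<exists>k<p. path_colour (i + k) \<noteq> path_colour (i + k + p)"
proof (rule ccontr)
  assume "\<not> ?thesis"
  then have sq: "path_colour (i + k) = path_colour (i + k + p)" if "k < p" for k using that by blast
  have "p \<noteq> 1" "p \<noteq> 2" using sq[of 0] path_colour_near[of i] by auto
  then have p3: "p \<ge> 3" using assms by auto
  have three: "path_colour n = 3 \<longleftrightarrow> n mod 3 = 2" for n
    using ternary_ge[of "2 * (n div 3) + n mod 3"] by (auto simp: path_colour_def nat_eq_iff nat_eq_iff2)
  \<comment> \<open>Every window of length three contains the inserted letter, so it forces the period to be a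
    multiple of three.\<close>
  obtain k where k: "k < 3" "(i + k) mod 3 = 2"
  proof -
    have "\<exists>k<3. (i + k) mod 3 = 2" by presburger
    then show ?thesis using that by blast
  qed
  then have "(i + k + p) mod 3 = 2" using sq[of k] three[of "i + k"] three[of "i + k + p"] p3 by auto
  then have "p mod 3 = 0" using k by presburger
  then obtain q where q: "p = 3 * q" by auto
  define m where "m = 2 * (i div 3) + i mod 3"
  have val: "path_colour (3 * (r div 2) + r mod 2) = nat (ternary r + 1)" for r
  proof -
    have r: "r mod 2 < 2" by simp
    have "(3 * (r div 2) + r mod 2) mod 3 = r mod 2" "(3 * (r div 2) + r mod 2) div 3 = r div 2"
      using r by auto
    then show ?thesis using r by (simp add: path_colour_def)
  qed
  have "ternary (m + l) = ternary (m + l + 2 * q)" if "l < 2 * q" for l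
  proof -
    let ?n = "3 * ((m + l) div 2) + (m + l) mod 2"
    \<comment> \<open>\<open>?n\<close> is the position of the ternary letter \<open>m + l\<close> in the new word.\<close>
    define u b w d where ubwd: "u = i div 3" "b = i mod 3" "w = (m + l) div 2" "d = (m + l) mod 2"
    have "i = 3 * u + b" "b < 3" "2 * w + d = 2 * u + b + l" "d < 2"
      unfolding ubwd m_def by auto
    then have "i \<le> 3 * w + d" "3 * w + d < i + p" unfolding q using that by presburger+
    then have "i \<le> ?n" "?n < i + p" unfolding ubwd by auto
    then have "path_colour ?n = path_colour (?n + p)" using sq[of "?n - i"] by auto
    moreover have "?n + p = 3 * ((m + l + 2 * q) div 2) + (m + l + 2 * q) mod 2" using q by simp
    ultimately have "nat (ternary (m + l) + 1) = nat (ternary (m + l + 2 * q) + 1)"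
      using val by metis
    then show ?thesis using ternary_ge[of "m + l"] ternary_ge[of "m + l + 2 * q"] by linarith
  qed
  moreover have "2 * q \<ge> 1" using q p3 by auto
  ultimately show False using ternary_squarefree[of "2 * q" m] by blast
qed

lemma lazy_walk_between:
  fixes a :: "nat \<Rightarrow> int"
  assumes lazy: "\<And>i. i < n \<Longrightarrow> \<bar>a (Suc i) - a i\<bar> \<le> 1" and "i \<le> n" "j \<le> n"
    and x: "a i \<le> x" "x \<le> a j"
  shows "\<exists>l\<le>n. a l = x"
proof (cases "i \<le> j")
  case True
  have "\<exists>l. i \<le> l \<and> l \<le> j \<and> a l = x"
    by (rule nat_intermed_int_val) (use assms True in auto)
  then show ?thesis using \<open>j \<le> n\<close> le_trans by blast
next
  case False
  have "\<exists>l. j \<le> l \<and> l \<le> i \<and> - a l = - x"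
  proof (rule nat_intermed_int_val)
    show "\<forall>l. j \<le> l \<and> l < i \<longrightarrow> \<bar>- a (Suc l) - - a l\<bar> \<le> 1"
    proof (intro allI impI)
      fix l assume "j \<le> l \<and> l < i"
      then show "\<bar>- a (Suc l) - - a l\<bar> \<le> 1" using lazy[of l] \<open>i \<le> n\<close> by linarith
    qed
  qed (use x False in auto)
  then show ?thesis using \<open>i \<le> n\<close> le_trans by fastforce
qed

text \<open>
  If any two of three consecutive vertices of the integer line have different colours, then the colour
  of the next vertex determines each step of a walk, once it is known in which direction the
  line is locally read.  A second walk with the same colours is therefore the image of the first
  under one translation or reflection \<open>x \<mapsto> s x + k\<close>: the first move fixes \<open>s\<close>, and
  later moves to new vertices have to go on in the same direction.
\<close>
lemma equally_coloured_lazy_walks: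
  fixes a b :: "nat \<Rightarrow> int" and C :: "int \<Rightarrow> nat"
  assumes near: "\<And>x y. \<lbrakk>x \<ge> 0; y \<ge> 0; 1 \<le> \<bar>x - y\<bar>; \<bar>x - y\<bar> \<le> 2\<rbrakk> \<Longrightarrow> C x \<noteq> C y"
    and lazy: "\<And>i. i < n \<Longrightarrow> \<bar>a (Suc i) - a i\<bar> \<le> 1" "\<And>i. i < n \<Longrightarrow> \<bar>b (Suc i) - b i\<bar> \<le> 1"
    and nonneg: "\<And>i. i \<le> n \<Longrightarrow> a i \<ge> 0" "\<And>i. i \<le> n \<Longrightarrow> b i \<ge> 0"
    and col: "\<And>i. i \<le> n \<Longrightarrow> C (a i) = C (b i)"
  shows "\<exists>s k. (s = 1 \<or> s = -1) \<and> (\<forall>i\<le>n. b i = s * a i + k)"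
  using assms
proof (induction n)
  case 0
  show ?case by (rule exI[of _ 1], rule exI[of _ "b 0 - a 0"]) simp
next
  case (Suc n)
  have "\<exists>s k. (s = 1 \<or> s = -1) \<and> (\<forall>i\<le>n. b i = s * a i + k)"
    by (rule Suc.IH) (use Suc.prems in auto)
  then obtain s k where s: "s = 1 \<or> s = -1" and k: "\<And>i. i \<le> n \<Longrightarrow> b i = s * a i + k"
    by blast
  define x x' y y' where xy: "x = a n" "x' = a (Suc n)" "y = b n" "y' = b (Suc n)"
  have y: "y = s * x + k" using k xy by auto
  have step: "\<bar>x' - x\<bar> \<le> 1" "\<bar>y' - y\<bar> \<le> 1" using Suc.prems(2,3)[of n] xy by auto
  have pos: "x \<ge> 0" "x' \<ge> 0" "y \<ge> 0" "y' \<ge> 0" using Suc.prems(4,5) xy by auto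
  have col: "C x = C y" "C x' = C y'" using Suc.prems(6) xy by auto
  have same: "u = w" if "C u = C w" "u \<ge> 0" "w \<ge> 0" "\<bar>u - w\<bar> \<le> 2" for u w
    using Suc.prems(1)[of u w] that by force
  have visited: "s * a i + k \<ge> 0" "C (a i) = C (s * a i + k)" if "i \<le> n" for i
    using Suc.prems(5)[of i] Suc.prems(6)[of i] k[OF that] that by auto
  consider (old) i where "i \<le> n" "a i = x'"
    | (straight) i where "i \<le> n" "a i = 2 * x - x'" "x' \<noteq> x"
    | (first) "\<And>i. i \<le> n \<Longrightarrow> a i = x" "x' \<noteq> x"
  proof -
    have "\<exists>l\<le>n. a l = x + 1 \<or> a l = x - 1" if "i \<le> n" "a i \<noteq> x" for i
    proof (cases "a i > x")
      case True
      then show ?thesis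
        using lazy_walk_between[of n a n i "x + 1"] Suc.prems(2) that xy by auto
    next
      case False
      then show ?thesis
        using lazy_walk_between[of n a i n "x - 1"] Suc.prems(2) that xy by auto
    qed
    moreover have "x' = x \<or> x' = x + 1 \<or> x' = x - 1" using step by auto
    ultimately show ?thesis
      using that xy by (smt (verit, best) order_refl)
  qed
  then show ?case
  proof cases
    case old
    have "\<bar>s * x' + k - y\<bar> \<le> 1" using s step y by auto
    then have "y' = s * x' + k"
      using same[of y' "s * x' + k"] visited[of i] old col pos step by auto
    then show ?thesis using s k xy by (metis le_Suc_eq)
  next
    case straight
    have "C x \<noteq> C x'" by (rule Suc.prems(1)) (use pos step straight(3) in linarith)+
    then have "C y' \<noteq> C y" using col by simp
    moreover have "C (2 * x - x') \<noteq> C x'"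
      by (rule Suc.prems(1)) (use pos step straight Suc.prems(4)[of i] in linarith)+
    then have "C y' \<noteq> C (s * (2 * x - x') + k)"
      using visited[of i] straight col by simp
    ultimately have "y' \<noteq> y" "y' \<noteq> s * (2 * x - x') + k" by auto
    then have "y' = s * x' + k"
      using s y step straight(3) by (elim disjE) (simp; presburger)+
    then show ?thesis using s k xy by (metis le_Suc_eq)
  next
    case first
    have "C x \<noteq> C x'" by (rule Suc.prems(1)) (use pos step first(2) in linarith)+
    then have "y' \<noteq> y" using col by auto
    then have "y' - y = 1 \<or> y' - y = -1" and x': "x' - x = 1 \<or> x' - x = -1"
      using step first(2) by linarith+
    then have "(y' - y) * (x' - x) = 1 \<or> (y' - y) * (x' - x) = -1"
      by (elim disjE) simp_all
    moreover have "b i = (y' - y) * (x' - x) * a i + (y - (y' - y) * (x' - x) * x)" if "i \<le> n" for i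
      using k[OF that] first(1)[OF that] y by simp
    moreover have "y' = (y' - y) * (x' - x) * x' + (y - (y' - y) * (x' - x) * x)"
    proof -
      have "(y' - y) * (x' - x) * x' + (y - (y' - y) * (x' - x) * x)
          = y + (y' - y) * ((x' - x) * (x' - x))"
        by (simp add: algebra_simps)
      also have "(x' - x) * (x' - x) = 1" using x' by (elim disjE) simp_all
      finally show ?thesis by simp
    qed
    ultimately show ?thesis using xy by (metis le_Suc_eq)
  qed
qed

text \<open>
  The two halves are related by \<open>x \<mapsto> s x + k\<close>.  Since the first half ends next to the start of the
  second one, a translation by \<open>k \<noteq> 0\<close> would produce a square of period \<open>\<bar>k\<bar>\<close> in the colour word,
  and for a reflection the first half would reach a vertex at distance one or two from its
  own mirror image, which has the same colour.
\<close>
theorem repetitive_lazy_walk: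
  fixes v :: "nat \<Rightarrow> nat"
  assumes lazy: "\<And>i. Suc i < 2 * t \<Longrightarrow> v (Suc i) \<le> v i + 1 \<and> v i \<le> v (Suc i) + 1"
    and rep: "\<And>i. i < t \<Longrightarrow> path_colour (v i) = path_colour (v (t + i))"
    and "i < t"
  shows "v i = v (t + i)"
proof (rule ccontr)
  assume ne: "v i \<noteq> v (t + i)"
  define C where "C x = path_colour (nat x)" for x
  define a b where ab: "a i = int (v i)" "b i = int (v (t + i))" for i
  have near: "C x \<noteq> C y" if "x \<ge> 0" "y \<ge> 0" "1 \<le> \<bar>x - y\<bar>" "\<bar>x - y\<bar> \<le> 2" for x y
  proof -
    consider "nat y = nat x + 1" | "nat y = nat x + 2" | "nat x = nat y + 1" | "nat x = nat y + 2"
      using \<open>x \<ge> 0\<close> \<open>y \<ge> 0\<close> \<open>1 \<le> \<bar>x - y\<bar>\<close> \<open>\<bar>x - y\<bar> \<le> 2\<close> by linarith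
    then show ?thesis
      unfolding C_def by cases (metis path_colour_near)+
  qed
  have square: "\<exists>l\<ge>0. l < p \<and> C (x + l) \<noteq> C (x + l + p)" if x: "x \<ge> 0" and p: "p \<ge> 1" for x p
  proof -
    have "1 \<le> nat p" using p by auto
    then obtain l where "l < nat p" "path_colour (nat x + l) \<noteq> path_colour (nat x + l + nat p)"
      using path_colour_squarefree by blast
    then show ?thesis
      using x p by (intro exI[of _ "int l"]) (auto simp: C_def nat_add_distrib)
  qed
  define n where "n = t - 1"
  have t: "t = Suc n" using \<open>i < t\<close> n_def by auto
  have lz: "\<bar>a (Suc i) - a i\<bar> \<le> 1" "\<bar>b (Suc i) - b i\<bar> \<le> 1" if "i < n" for i
    using lazy[of i] lazy[of "t + i"] that t ab by auto
  have pos: "a i \<ge> 0" "b i \<ge> 0" for i using ab by auto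
  have col: "C (a i) = C (b i)" if "i \<le> n" for i
    using rep[of i] that t by (auto simp: C_def ab)
  have "\<exists>s k. (s = 1 \<or> s = -1) \<and> (\<forall>i\<le>n. b i = s * a i + k)"
    by (rule equally_coloured_lazy_walks[of C]) (use near lz pos col in auto)
  then obtain s k where s: "s = 1 \<or> s = -1" and k: "\<And>i. i \<le> n \<Longrightarrow> b i = s * a i + k"
    by blast
  have link: "\<bar>b 0 - a n\<bar> \<le> 1" using lazy[of n] t by (auto simp: ab)
  have visited: "C x = C (s * x + k) \<and> x \<ge> 0 \<and> s * x + k \<ge> 0"
    if ij: "i \<le> n" "j \<le> n" "a i \<le> x" "x \<le> a j" for x i j
  proof -
    obtain l where l: "l \<le> n" "a l = x"
      using lazy_walk_between[of n a, OF lz(1) ij] by blast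
    then show ?thesis using k[OF l(1)] col[OF l(1)] pos[of l] by simp
  qed
  have i: "i \<le> n" "a i \<noteq> b i" using ne \<open>i < t\<close> t ab by auto
  show False
  proof (cases "s = 1")
    case True
    have b0: "b 0 = a 0 + k" using k[of 0] True by auto
    have "k \<noteq> 0" using k[of i] i True by auto
    then consider "k \<ge> 1" | "k \<le> -1" by linarith
    then show False
    proof cases
      case 1
      then obtain l where l: "l \<ge> 0" "l < k" "C (a 0 + l) \<noteq> C (a 0 + l + k)"
        using square[of "a 0" k] pos by auto
      then show False
        using visited[of 0 n "a 0 + l"] link b0 True by auto
    next
      case 2
      have *: "a n \<le> a 0 + k + 1" using link b0 by auto
      have x0: "a 0 + 2 * k + 1 \<ge> 0"
        using visited[of n 0 "a 0 + k + 1"] * 2 True by auto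
      then obtain l where l: "l \<ge> 0" "l < - k" "C (a 0 + 2 * k + 1 + l) \<noteq> C (a 0 + 2 * k + 1 + l + - k)"
        using square[of "a 0 + 2 * k + 1" "- k"] 2 by auto
      then show False
        using visited[of n 0 "a 0 + k + 1 + l"] * True by (simp add: algebra_simps)
    qed
  next
    case False
    then have s: "s = -1" using s by auto
    have b0: "b 0 = k - a 0" using k[of 0] s by auto
    have sym: False
      if ij: "i \<le> n" "j \<le> n" "a i \<le> x" "x \<le> a j" and x: "1 \<le> \<bar>k - 2 * x\<bar>" "\<bar>k - 2 * x\<bar> \<le> 2" for i j x
    proof -
      have v: "C x = C (k - x)" "x \<ge> 0" "k - x \<ge> 0" using visited[OF ij] s by simp_all
      have "C x \<noteq> C (k - x)" by (rule near) (use v(2,3) x in linarith)+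
      then show False using v(1) by simp
    qed
    \<comment> \<open>A walk from \<open>p\<close> to \<open>q\<close> comes close to the centre \<open>k / 2\<close> of the reflection if \<open>q\<close> is close to the
      image \<open>k - p\<close> of \<open>p\<close>.  Only a walk that starts at the centre itself may fail to do so.\<close>
    have mid: "\<exists>x. p \<le> x \<and> x \<le> q \<and> 1 \<le> \<bar>k - 2 * x\<bar> \<and> \<bar>k - 2 * x\<bar> \<le> 2"
      if "p \<le> q" "\<bar>k - p - q\<bar> \<le> 1" "p \<noteq> q \<or> k \<noteq> 2 * p" for p q :: int
    proof -
      consider "q = p" | "q = p + 1" | "q \<ge> p + 2" using \<open>p \<le> q\<close> by linarith
      then show ?thesis
      proof cases
        case 3
        show ?thesis
          by (rule exI[of _ "if even k then (if p \<le> k div 2 - 1 then k div 2 - 1 else k div 2 + 1) else k div 2"])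
            (use 3 that in \<open>auto elim!: evenE oddE\<close>)
      next
        case 2
        show ?thesis
          by (rule exI[of _ "if k = p + q - 1 then q else p"]) (use 2 that in auto)
      qed (use that in \<open>auto intro!: exI[of _ p]\<close>)
    qed
    show False
    proof (cases "a 0 = a n \<and> k = 2 * a 0")
      case True
      have "a i \<noteq> a 0" using k[of i] i s True by auto
      then consider "a 0 + 1 \<le> a i" | "a i \<le> a 0 - 1" by linarith
      then show False
        using sym[of 0 i "a 0 + 1"] sym[of i 0 "a 0 - 1"] i True by cases auto
    next
      case False
      consider "a 0 \<le> a n" | "a n \<le> a 0" by linarith
      then show False
      proof cases
        case 1
        have "\<bar>k - a 0 - a n\<bar> \<le> 1" using link b0 by linarith
        then show False using mid[OF 1] False sym[of 0 n] by auto
      next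
        case 2
        have "\<bar>k - a n - a 0\<bar> \<le> 1" using link b0 by linarith
        then show False using mid[OF 2] False sym[of n 0] by auto
      qed
    qed
  qed
qed

section \<open>Separating a triangulated grid by two routes\<close>

type_synonym cell = "nat \<times> nat"

text \<open>
  The cells are the vertices of a triangulated square: besides the horizontal and vertical
  neighbours, the two cells on each rising diagonal are adjacent.  The unit square with lower left corner
  \<open>(i, j)\<close> consists of a lower triangle, with third vertex \<open>(i + 1, j)\<close>, and an upper
  triangle, with third vertex \<open>(i, j + 1)\<close>.
\<close>
definition up_adj :: "cell \<Rightarrow> cell \<Rightarrow> bool" where
  "up_adj x y \<longleftrightarrow> y = (Suc (fst x), snd x) \<or> y = (fst x, Suc (snd x)) \<or> y = (Suc (fst x), Suc (snd x))"

definition grid_adj :: "cell \<Rightarrow> cell \<Rightarrow> bool" where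
  "grid_adj x y \<longleftrightarrow> up_adj x y \<or> up_adj y x"

lemma grid_adj_commute: "grid_adj x y \<longleftrightarrow> grid_adj y x"
  by (auto simp: grid_adj_def)

definition grid :: "nat \<Rightarrow> cell set" where
  "grid M = {..M} \<times> {..M}"

definition inner_grid :: "nat \<Rightarrow> cell set" where
  "inner_grid M = {0<..<M} \<times> {0<..<M}"

text \<open>
  Whether the edge \<open>x y\<close> crosses the horizontal ray that goes to the left from the interior of
  the lower triangle at \<open>z\<close>.  The parity of the number of crossings decides on which side
  of a closed curve this triangle lies, and a vertex \<open>z\<close> off the curve is on the side of its
  triangles.
\<close>
definition crosses :: "cell \<Rightarrow> cell \<Rightarrow> cell \<Rightarrow> bool" where
  "crosses z x y \<longleftrightarrow>
     snd x = snd z \<and> snd y = Suc (snd z) \<and> fst x \<le> fst z \<or>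
     snd y = snd z \<and> snd x = Suc (snd z) \<and> fst y \<le> fst z"

text \<open>A ray crosses the boundary of a triangle in an even number of edges unless it starts inside.\<close>
lemma crosses_lower_triangle:
  "z \<noteq> (i, j) \<Longrightarrow>
    (crosses z (i, j) (Suc i, j) \<noteq> crosses z (Suc i, j) (Suc i, Suc j)) = crosses z (i, j) (Suc i, Suc j)"
  by (cases z) (auto simp: crosses_def)

lemma crosses_upper_triangle:
  "z \<noteq> (i, j) \<Longrightarrow>
    (crosses z (i, j) (i, Suc j) \<noteq> crosses z (i, Suc j) (Suc i, Suc j)) = crosses z (i, j) (Suc i, Suc j)"
  by (cases z) (auto simp: crosses_def)

text \<open>
  When the starting triangle moves to a vertex \<open>z'\<close> in the next row, the two rays differ by the
  grid vertices of that row up to \<open>z'\<close>.  An edge not meeting \<open>z\<close> and \<open>z'\<close> crosses exactly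
  one of the rays iff it has exactly one end among these vertices.  If \<open>z'\<close> lies in the same row,
  the difference only concerns edges at \<open>z'\<close>, and the set is empty.
\<close>
definition ray :: "cell \<Rightarrow> cell \<Rightarrow> cell \<Rightarrow> bool" where
  "ray z z' v \<longleftrightarrow> snd z' = Suc (snd z) \<and> snd v = snd z' \<and> fst v \<le> fst z'"

lemma crosses_commute: "crosses z x y = crosses z y x"
  by (auto simp: crosses_def)

lemma crosses_up:
  "crosses (a, b) (c, d) (Suc c, d) = False"
  "crosses (a, b) (c, d) (c, Suc d) \<longleftrightarrow> d = b \<and> c \<le> a"
  "crosses (a, b) (c, d) (Suc c, Suc d) \<longleftrightarrow> d = b \<and> c \<le> a"
  by (auto simp: crosses_def)

lemma crosses_neighbour:
  assumes zz': "up_adj z z'" and "grid_adj x y" "x \<notin> {z, z'}" "y \<notin> {z, z'}"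
  shows "(crosses z x y \<noteq> crosses z' x y) = (ray z z' x \<noteq> ray z z' y)"
proof -
  have up: "(crosses z x y \<noteq> crosses z' x y) = (ray z z' x \<noteq> ray z z' y)"
    if "up_adj x y" "x \<noteq> z" "x \<noteq> z'" "y \<noteq> z" "y \<noteq> z'" for x y
  proof -
    obtain a b c d where zx: "z = (a, b)" "x = (c, d)"
      by (metis surj_pair)
    have "y = (Suc c, d) \<or> y = (c, Suc d) \<or> y = (Suc c, Suc d)"
      using \<open>up_adj x y\<close> zx by (auto simp: up_adj_def)
    moreover have "z' = (Suc a, b) \<or> z' = (a, Suc b) \<or> z' = (Suc a, Suc b)"
      using zz' zx by (auto simp: up_adj_def)
    ultimately show ?thesis
      using that(2-) unfolding zx
      by (elim disjE; hypsubst; simp only: crosses_up ray_def fst_conv snd_conv prod.inject; presburger)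
  qed
  show ?thesis
    using up[of x y] up[of y x] assms crosses_commute[of _ x y] unfolding grid_adj_def by auto
qed

text \<open>
  A walk from the origin to a cell, remembered only by the set of its vertices and by the parity
  with which it crosses the ray of each cell.
\<close>
inductive route :: "cell set \<Rightarrow> cell \<Rightarrow> (cell \<Rightarrow> bool) \<Rightarrow> bool" where
  start: "route {(0, 0)} (0, 0) (\<lambda>_. False)"
| step: "route S y q \<Longrightarrow> grid_adj x y \<Longrightarrow> route (insert x S) x (\<lambda>z. q z \<noteq> crosses z x y)"

lemma route_end: "route S x q \<Longrightarrow> x \<in> S"
  by (induction rule: route.induct) auto

lemma route_parity_neighbour:
  assumes "route S x q" "up_adj z z'" "z \<notin> S" "z' \<notin> S"
  shows "(q z \<noteq> q z') = (ray z z' x \<noteq> ray z z' (0, 0))"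
  using assms
proof (induction rule: route.induct)
  case (step S y q x)
  have "(crosses z x y \<noteq> crosses z' x y) = (ray z z' x \<noteq> ray z z' y)"
    by (rule crosses_neighbour) (use step route_end[OF step.hyps(1)] in auto)
  moreover have "(q z \<noteq> q z') = (ray z z' y \<noteq> ray z z' (0, 0))"
    using step by auto
  ultimately show ?case by argo
qed auto

text \<open>
  The side on which \<open>z\<close> lies of the closed walk formed by two routes and the edge \<open>x y\<close>
  between their ends.
\<close>
definition route_side :: "cell \<Rightarrow> (cell \<Rightarrow> bool) \<Rightarrow> cell \<Rightarrow> (cell \<Rightarrow> bool) \<Rightarrow> cell \<Rightarrow> bool" where
  "route_side x q y q' z \<longleftrightarrow> (crosses z x y \<noteq> (q z \<noteq> q' z))"

text \<open>
  The contributions of the \<^const>\<open>ray\<close> sets telescope along the closed walk, hence the side cannot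
  change between adjacent cells off the walk.  This is the part of the Jordan curve theorem
  that separators need.
\<close>
lemma route_side_neighbour:
  assumes "route S x q" "route S' y q'" "grid_adj x y" "grid_adj z z'" "{z, z'} \<inter> (S \<union> S') = {}"
  shows "route_side x q y q' z = route_side x q y q' z'"
proof -
  have *: "route_side x q y q' z = route_side x q y q' z'"
    if "up_adj z z'" "{z, z'} \<inter> (S \<union> S') = {}" for z z'
  proof -
    have "(crosses z x y \<noteq> crosses z' x y) = (ray z z' x \<noteq> ray z z' y)"
      by (rule crosses_neighbour) (use that assms route_end[OF assms(1)] route_end[OF assms(2)] in auto)
    moreover have "(q z \<noteq> q z') = (ray z z' x \<noteq> ray z z' (0, 0))"
      by (rule route_parity_neighbour) (use that assms in auto)
    moreover have "(q' z \<noteq> q' z') = (ray z z' y \<noteq> ray z z' (0, 0))"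
      by (rule route_parity_neighbour) (use that assms in auto)
    ultimately show ?thesis unfolding route_side_def by argo
  qed
  show ?thesis
    using assms(4,5) *[of z z'] *[of z' z] unfolding grid_adj_def by auto
qed

text \<open>
  The parities of a route inside the boundary of the square which goes down along the left side
  if \<open>x\<close> is on it, and otherwise reaches the origin without using the left side.  Rays go to
  the left, so they only cross the former routes.
\<close>
definition ring_parity :: "nat \<Rightarrow> cell \<Rightarrow> (cell \<Rightarrow> bool) \<Rightarrow> bool" where
  "ring_parity M x q \<longleftrightarrow> (\<forall>z\<in>inner_grid M. q z \<longleftrightarrow> fst x = 0 \<and> snd z < snd x)"

lemma ring_route:
  assumes "x \<in> grid M - inner_grid M"
  shows "\<exists>S q. route S x q \<and> S \<subseteq> grid M - inner_grid M \<and> ring_parity M x q"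
proof -
  define good where
    "good x \<longleftrightarrow> (\<exists>S q. route S x q \<and> S \<subseteq> grid M - inner_grid M \<and> ring_parity M x q)" for x
  have step: "good x"
    if "good y" "grid_adj x y" "x \<in> grid M - inner_grid M"
      and parity: "\<And>z. z \<in> inner_grid M \<Longrightarrow>
        (fst x = 0 \<and> snd z < snd x) = ((fst y = 0 \<and> snd z < snd y) \<noteq> crosses z x y)" for x y
  proof -
    from that obtain S q where "route S y q" "S \<subseteq> grid M - inner_grid M" "ring_parity M y q"
      unfolding good_def by auto
    moreover from this have "route (insert x S) x (\<lambda>z. q z \<noteq> crosses z x y)"
      using \<open>grid_adj x y\<close> by (intro route.step)
    moreover have "ring_parity M x (\<lambda>z. q z \<noteq> crosses z x y)"
      unfolding ring_parity_def
    proof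
      fix z assume "z \<in> inner_grid M"
      then show "(q z \<noteq> crosses z x y) = (fst x = 0 \<and> snd z < snd x)"
        using parity[of z] \<open>ring_parity M y q\<close> by (simp add: ring_parity_def)
    qed
    ultimately have "route (insert x S) x (\<lambda>z. q z \<noteq> crosses z x y) \<and>
        insert x S \<subseteq> grid M - inner_grid M \<and> ring_parity M x (\<lambda>z. q z \<noteq> crosses z x y)"
      using \<open>x \<in> grid M - inner_grid M\<close> by simp
    then show ?thesis unfolding good_def by blast
  qed
  have origin: "good (0, 0)"
    unfolding good_def ring_parity_def using route.start
    by (auto simp: grid_def inner_grid_def intro!: exI[of _ "{(0, 0)}"] exI[of _ "\<lambda>_. False"])
  have left: "good (0, j)" if "j \<le> M" for j
    using that
  proof (induction j)
    case (Suc j)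
    show ?case
      by (rule step[of "(0, j)"]) (use Suc in \<open>auto simp: grid_adj_def up_adj_def grid_def inner_grid_def crosses_def\<close>)
  qed (rule origin)
  have bottom: "good (i, 0)" if "i \<le> M" for i
    using that
  proof (induction i)
    case (Suc i)
    show ?case
      by (rule step[of "(i, 0)"]) (use Suc in \<open>auto simp: grid_adj_def up_adj_def grid_def inner_grid_def crosses_def\<close>)
  qed (rule origin)
  have right: "good (M, j)" if "j \<le> M" "M > 0" for j
    using that
  proof (induction j)
    case 0
    then show ?case using bottom by simp
  next
    case (Suc j)
    show ?case
      by (rule step[of "(M, j)"]) (use Suc in \<open>auto simp: grid_adj_def up_adj_def grid_def inner_grid_def crosses_def\<close>)
  qed
  have top: "good (M - i, M)" if "i < M" for i
    using that
  proof (induction i)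
    case 0
    then show ?case using right by simp
  next
    case (Suc i)
    show ?case
      by (rule step[of "(M - i, M)"]) (use Suc in \<open>auto simp: grid_adj_def up_adj_def grid_def inner_grid_def crosses_def\<close>)
  qed
  obtain i j where x: "x = (i, j)" by (cases x)
  then have "i = 0 \<or> j = 0 \<or> i = M \<or> j = M" "i \<le> M" "j \<le> M"
    using assms by (auto simp: grid_def inner_grid_def)
  then have "good x"
    using x left[of j] bottom[of i] right[of j] top[of "M - i"] by (cases "i = 0") auto
  then show ?thesis unfolding good_def .
qed

lemma three_large_subsets_meet:
  assumes "finite U" "A \<subseteq> U" "B \<subseteq> U" "C \<subseteq> U"
    and "3 * card A > 2 * card U" "3 * card B > 2 * card U" "3 * card C > 2 * card U"
  shows "A \<inter> B \<inter> C \<noteq> {}"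
proof
  assume "A \<inter> B \<inter> C = {}"
  then have "U = (U - A) \<union> (U - B) \<union> (U - C)" by auto
  then have "card U = card ((U - A) \<union> (U - B) \<union> (U - C))" by simp
  then have "card U \<le> card (U - A) + card (U - B) + card (U - C)"
    using card_Un_le[of "(U - A) \<union> (U - B)" "U - C"] card_Un_le[of "U - A" "U - B"] by linarith
  moreover have "card (U - X) = card U - card X" if "X \<subseteq> U" for X
    using that assms(1) by (metis card_Diff_subset finite_subset)
  ultimately have "card U \<le> (card U - card A) + (card U - card B) + (card U - card C)"
    using assms by simp
  moreover have "card A \<le> card U" "card B \<le> card U" "card C \<le> card U"
    using assms by (auto intro: card_mono)
  ultimately show False using assms by linarith
qed

text \<open>
  In each unit square the diagonal cancels, and the parity of the four outer edges is even.
  Within a row of squares the vertical edges cancel, so all rows have the parity of the bottom side.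
\<close>
lemma cocycle_on_grid:
  fixes h :: "cell \<Rightarrow> cell \<Rightarrow> bool"
  assumes lower: "\<And>i j. i < M \<Longrightarrow> j < M \<Longrightarrow>
      (h (i, j) (Suc i, j) \<noteq> h (Suc i, j) (Suc i, Suc j)) = h (i, j) (Suc i, Suc j)"
    and upper: "\<And>i j. i < M \<Longrightarrow> j < M \<Longrightarrow>
      (h (i, j) (i, Suc j) \<noteq> h (i, Suc j) (Suc i, Suc j)) = h (i, j) (Suc i, Suc j)"
    and left: "\<And>j. j < M \<Longrightarrow> \<not> h (0, j) (0, Suc j)" and right: "\<And>j. j < M \<Longrightarrow> \<not> h (M, j) (M, Suc j)"
    and bottom: "\<And>i. i < M \<Longrightarrow> \<not> h (i, 0) (Suc i, 0)"
  shows "even (card {i. i < M \<and> h (i, M) (Suc i, M)})"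
proof -
  define row where "row m j = (\<Sum>i<m. of_bool (h (i, j) (Suc i, j)) :: nat)" for m j
  have "even (row m j + row m (Suc j)) = (h (0, j) (0, Suc j) = h (m, j) (m, Suc j))"
    if "m \<le> M" "j < M" for m j
    using that
  proof (induction m)
    case (Suc m)
    then show ?case using lower[of m j] upper[of m j] unfolding row_def by (simp, argo)
  qed (simp add: row_def)
  then have step: "even (row M j + row M (Suc j))" if "j < M" for j
    using left right that by auto
  have "even (row M j)" if "j \<le> M" for j
    using that
  proof (induction j)
    case 0
    then show ?case using bottom by (simp add: row_def)
  next
    case (Suc j)
    then show ?case using step[of j] by auto
  qed
  moreover have "row M M = card {i. i < M \<and> h (i, M) (Suc i, M)}"
  proof -
    have "{i. i < M \<and> h (i, M) (Suc i, M)} = {..<M} \<inter> {i. h (i, M) (Suc i, M)}" by auto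
    then show ?thesis unfolding row_def by simp
  qed
  ultimately show ?thesis by (metis order_refl)
qed

text \<open>
  If all pairs failed, every grid edge would have a heavy side, and the relation "the heavy side is the
  inside" would satisfy the hypotheses of \<open>cocycle_on_grid\<close> while holding for exactly one edge of the
  top side.  The set \<open>K u\<close> stands for the region of \<open>u\<close>: an element whose region is met by one of
  the two routes counts for neither side.
\<close>
theorem balanced_route_pair:
  fixes U :: "'v set" and rep :: "'v \<Rightarrow> cell" and K :: "'v \<Rightarrow> cell set"
    and S :: "cell \<Rightarrow> cell set" and q :: "cell \<Rightarrow> cell \<Rightarrow> bool"
  assumes "M > 0" "finite U"
    and rep: "\<And>u. u \<in> U \<Longrightarrow> rep u \<in> inner_grid M \<and> rep u \<in> K u"
    and route: "\<And>x. x \<in> grid M \<Longrightarrow> route (S x) x (q x)"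
    and ring: "\<And>x. x \<in> grid M - inner_grid M \<Longrightarrow> ring_parity M x (q x)"
  shows "\<exists>x\<in>grid M. \<exists>y\<in>grid M. grid_adj x y \<and>
    (\<forall>b. 3 * card {u \<in> U. K u \<inter> (S x \<union> S y) = {} \<and> route_side x (q x) y (q y) (rep u) = b} \<le> 2 * card U)"
proof (rule ccontr)
  assume contra: "\<not> ?thesis"
  define part where
    "part b x y = {u \<in> U. K u \<inter> (S x \<union> S y) = {} \<and> route_side x (q x) y (q y) (rep u) = b}" for b x y
  define h where "h x y \<longleftrightarrow> 3 * card (part True x y) > 2 * card U" for x y
  have heavy: "3 * card (part (h x y) x y) > 2 * card U" if xy: "x \<in> grid M" "y \<in> grid M" "grid_adj x y" for x y
  proof -
    obtain b where "\<not> 3 * card (part b x y) \<le> 2 * card U"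
      using contra xy unfolding part_def by blast
    then have "3 * card (part b x y) > 2 * card U" by simp
    then show ?thesis
      using h_def[of x y] by (cases "h x y"; cases b) simp_all
  qed
  have no_part: "part b x y \<noteq> {}" if "x \<in> grid M" "y \<in> grid M" "grid_adj x y" "h x y = b" for b x y
    using heavy[OF that(1-3)] that(4) by auto
  \<comment> \<open>An element on the heavy sides of all three walks of a triangle avoids the routes.  There the
    routes cancel in pairs, and what remains are the crossings with the triangle itself.\<close>
  have triangle: "(h x y \<noteq> h y w) = h x w"
    if "x \<in> grid M" "y \<in> grid M" "w \<in> grid M" "grid_adj x y" "grid_adj y w" "grid_adj x w"
      and cr: "\<And>z. z \<noteq> x \<Longrightarrow> (crosses z x y \<noteq> crosses z y w) = crosses z x w" for x y w
  proof -
    have "part (h x y) x y \<inter> part (h y w) y w \<inter> part (h x w) x w \<noteq> {}"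
      by (rule three_large_subsets_meet[OF \<open>finite U\<close>]) (use heavy that in \<open>auto simp: part_def\<close>)
    then obtain u where u: "u \<in> part (h x y) x y" "u \<in> part (h y w) y w" "u \<in> part (h x w) x w"
      by blast
    then have "rep u \<noteq> x"
      using rep[of u] route_end[OF route[OF that(1)]] by (auto simp: part_def)
    then show ?thesis
      using u cr[of "rep u"] unfolding part_def route_side_def by auto
  qed
  \<comment> \<open>For an edge of the boundary, all inner cells lie on one side, which then is the heavy one.  This is
    the inside only for the leftmost edge of the top side, where the two ways to the origin meet.\<close>
  have on_ring: "h x y = b"
    if xy: "x \<in> grid M - inner_grid M" "y \<in> grid M - inner_grid M" "grid_adj x y"
      and cr: "\<And>i j. 0 < i \<Longrightarrow> i < M \<Longrightarrow> 0 < j \<Longrightarrow> j < M \<Longrightarrow>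
        (crosses (i, j) x y \<noteq> ((fst x = 0 \<and> j < snd x) \<noteq> (fst y = 0 \<and> j < snd y))) = b"
    for x y b
  proof -
    have "route_side x (q x) y (q y) z = b" if z: "z \<in> inner_grid M" for z
    proof -
      have "q x z = (fst x = 0 \<and> snd z < snd x)" "q y z = (fst y = 0 \<and> snd z < snd y)"
        using ring[OF xy(1)] ring[OF xy(2)] z by (simp_all add: ring_parity_def)
      then show ?thesis
        using cr[of "fst z" "snd z"] z by (simp add: route_side_def inner_grid_def mem_Times_iff)
    qed
    then have "part (\<not> b) x y = {}" using rep by (auto simp: part_def)
    then show ?thesis using no_part[of x y "\<not> b"] xy by blast
  qed
  have "even (card {i. i < M \<and> h (i, M) (Suc i, M)})"
  proof (rule cocycle_on_grid)
    fix i j assume "i < M" "j < M"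
    then show "(h (i, j) (Suc i, j) \<noteq> h (Suc i, j) (Suc i, Suc j)) = h (i, j) (Suc i, Suc j)"
      by (intro triangle crosses_lower_triangle) (auto simp: grid_def grid_adj_def up_adj_def)
  next
    fix i j assume "i < M" "j < M"
    then show "(h (i, j) (i, Suc j) \<noteq> h (i, Suc j) (Suc i, Suc j)) = h (i, j) (Suc i, Suc j)"
      by (intro triangle crosses_upper_triangle) (auto simp: grid_def grid_adj_def up_adj_def)
  next
    fix j assume "j < M"
    then have "h (0, j) (0, Suc j) = False"
      by (intro on_ring) (auto simp: grid_def inner_grid_def grid_adj_def up_adj_def crosses_def)
    then show "\<not> h (0, j) (0, Suc j)" by simp
  next
    fix j assume "j < M"
    then have "h (M, j) (M, Suc j) = False"
      by (intro on_ring) (auto simp: grid_def inner_grid_def grid_adj_def up_adj_def crosses_def)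
    then show "\<not> h (M, j) (M, Suc j)" by simp
  next
    fix i assume "i < M"
    then have "h (i, 0) (Suc i, 0) = False"
      by (intro on_ring) (auto simp: grid_def inner_grid_def grid_adj_def up_adj_def crosses_def)
    then show "\<not> h (i, 0) (Suc i, 0)" by simp
  qed
  moreover have "h (i, M) (Suc i, M) = (i = 0)" if "i < M" for i
    by (rule on_ring) (use that in \<open>auto simp: grid_def inner_grid_def grid_adj_def up_adj_def crosses_def\<close>)
  then have "{i. i < M \<and> h (i, M) (Suc i, M)} = {0}" using \<open>M > 0\<close> by auto
  ultimately show False by simp
qed

section \<open>Layered separators from grid labellings\<close>

text \<open>
  Connectedness by the absence of proper nonempty closed subsets, the form in which it follows from
  topological connectedness and in which it is used to propagate properties.
\<close>
definition grid_connected :: "cell set \<Rightarrow> bool" where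
  "grid_connected S \<longleftrightarrow> (\<forall>A\<subseteq>S. A \<noteq> {} \<longrightarrow> (\<forall>x\<in>A. \<forall>y\<in>S. grid_adj x y \<longrightarrow> y \<in> A) \<longrightarrow> A = S)"

lemma grid_connected_induct:
  assumes "grid_connected S" "x \<in> S" "P x" "y \<in> S"
    and "\<And>x y. x \<in> S \<Longrightarrow> y \<in> S \<Longrightarrow> grid_adj x y \<Longrightarrow> P x \<Longrightarrow> P y"
  shows "P y"
proof -
  have "{z \<in> S. P z} = S"
    using assms(1)[unfolded grid_connected_def, rule_format, of "{z \<in> S. P z}"] assms(2-) by blast
  then show ?thesis using \<open>y \<in> S\<close> by blast
qed

definition contact :: "nat \<Rightarrow> (cell \<Rightarrow> 'b) \<Rightarrow> ('b \<times> 'b) set" where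
  "contact M f = {(f x, f y) | x y. x \<in> grid M \<and> y \<in> grid M \<and> grid_adj x y}"

lemma contactI: "x \<in> grid M \<Longrightarrow> y \<in> grid M \<Longrightarrow> grid_adj x y \<Longrightarrow> (f x, f y) \<in> contact M f"
  unfolding contact_def by blast

lemma contact_sym: "(a, b) \<in> contact M f \<Longrightarrow> (b, a) \<in> contact M f"
  unfolding contact_def using grid_adj_commute by blast

text \<open>The layer of a label is its distance from the label of the corner in the contact graph.\<close>
lemma contact_layering:
  fixes f :: "cell \<Rightarrow> 'b"
  shows "\<exists>layer :: 'b \<Rightarrow> nat.
    (\<forall>x\<in>grid M. layer (f x) = 0 \<longleftrightarrow> f x = f (0, 0)) \<and>
    (\<forall>a b. (a, b) \<in> contact M f \<longrightarrow> layer b \<le> Suc (layer a)) \<and>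
    (\<forall>x\<in>grid M. \<forall>d. layer (f x) = Suc d \<longrightarrow> (\<exists>b. (f x, b) \<in> contact M f \<and> layer b = d))"
proof -
  let ?R = "contact M f"
  define layer where "layer a = (LEAST d. (f (0, 0), a) \<in> ?R ^^ d)" for a
  have corner: "\<exists>d. (f (0, 0), f (i, 0)) \<in> ?R ^^ d" if "i \<le> M" for i
    using that
  proof (induction i)
    case (Suc i)
    then obtain d where "(f (0, 0), f (i, 0)) \<in> ?R ^^ d" by auto
    moreover have "(f (i, 0), f (Suc i, 0)) \<in> ?R"
      by (rule contactI) (use Suc.prems in \<open>auto simp: grid_def grid_adj_def up_adj_def\<close>)
    ultimately show ?case by (meson relpow_Suc_I)
  qed (auto intro: exI[of _ 0])
  have reach: "\<exists>d. (f (0, 0), f x) \<in> ?R ^^ d" if "x \<in> grid M" for x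
  proof -
    have "\<exists>d. (f (0, 0), f (fst x, j)) \<in> ?R ^^ d" if "j \<le> M" for j
      using that
    proof (induction j)
      case 0
      show ?case using corner \<open>x \<in> grid M\<close> by (auto simp: grid_def)
    next
      case (Suc j)
      then obtain d where "(f (0, 0), f (fst x, j)) \<in> ?R ^^ d" by auto
      moreover have "(f (fst x, j), f (fst x, Suc j)) \<in> ?R"
        by (rule contactI) (use Suc.prems \<open>x \<in> grid M\<close> in \<open>auto simp: grid_def grid_adj_def up_adj_def\<close>)
      ultimately show ?case by (meson relpow_Suc_I)
    qed
    from this[of "snd x"] show ?thesis using \<open>x \<in> grid M\<close> by (auto simp: grid_def)
  qed
  have reach': "\<exists>d. (f (0, 0), a) \<in> ?R ^^ d" if "(a, b) \<in> ?R" for a b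
    using reach that unfolding contact_def by auto
  have layerI: "(f (0, 0), a) \<in> ?R ^^ layer a" if "\<exists>d. (f (0, 0), a) \<in> ?R ^^ d" for a
    unfolding layer_def using LeastI_ex[OF that] .
  have layer_le: "layer a \<le> d" if "(f (0, 0), a) \<in> ?R ^^ d" for a d
    unfolding layer_def using that by (rule Least_le)
  have step: "layer b \<le> Suc (layer a)" if "(a, b) \<in> ?R" for a b
    using layerI[OF reach'[OF that]] that by (intro layer_le) (rule relpow_Suc_I)
  have down: "\<exists>b. (f x, b) \<in> ?R \<and> layer b = d" if "x \<in> grid M" "layer (f x) = Suc d" for x d
  proof -
    have "(f (0, 0), f x) \<in> ?R ^^ Suc d" using layerI[OF reach[OF that(1)]] that(2) by simp
    then obtain b where b: "(f (0, 0), b) \<in> ?R ^^ d" "(b, f x) \<in> ?R" by (rule relpow_Suc_E)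
    then have "layer b = d" using layer_le[OF b(1)] step[OF b(2)] that(2) by linarith
    then show ?thesis using contact_sym[OF b(2)] by blast
  qed
  have zero: "layer (f x) = 0 \<longleftrightarrow> f x = f (0, 0)" if "x \<in> grid M" for x
    using layerI[OF reach[OF that]] layer_le[of "f (0, 0)" 0] by auto
  show ?thesis
    by (rule exI[of _ layer]) (use zero step down in blast)
qed

text \<open>
  The label \<open>None\<close> covers the boundary of the square.  Any other cell with this label has a left
  neighbour with the same label, so that it can be joined to the boundary.
\<close>
definition grid_labelling :: "nat \<Rightarrow> (cell \<Rightarrow> 'a option) \<Rightarrow> bool" where
  "grid_labelling M f \<longleftrightarrow>
     (\<forall>x\<in>grid M - inner_grid M. f x = None) \<and>
     (\<forall>i j. (Suc i, j) \<in> inner_grid M \<longrightarrow> f (Suc i, j) = None \<longrightarrow> f (i, j) = None) \<and>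
     (\<forall>v. grid_connected {x \<in> grid M. f x = Some v})"

definition layered_labels :: "(cell \<Rightarrow> 'b) \<Rightarrow> ('b \<Rightarrow> nat) \<Rightarrow> cell set \<Rightarrow> bool" where
  "layered_labels f layer S \<longleftrightarrow> (\<forall>y\<in>S. \<forall>z\<in>S. layer (f y) = layer (f z) \<longrightarrow> f y = f z)"

text \<open>
  The route runs inside the region of the current label to a cell touching a label of the previous
  layer, and continues from there.  It meets one label in each layer.
\<close>
lemma layered_route:
  fixes f :: "cell \<Rightarrow> 'a option"
  assumes f: "grid_labelling M f"
    and zero: "\<And>x. x \<in> grid M \<Longrightarrow> layer (f x) = 0 \<longleftrightarrow> f x = None"
    and down: "\<And>x d. x \<in> grid M \<Longrightarrow> layer (f x) = Suc d \<Longrightarrow> \<exists>b. (f x, b) \<in> contact M f \<and> layer b = d"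
    and "x \<in> grid M"
  shows "\<exists>S q. route S x q \<and> S \<subseteq> grid M \<and> layered_labels f layer S \<and> (\<forall>y\<in>S. layer (f y) \<le> layer (f x)) \<and>
    (x \<in> grid M - inner_grid M \<longrightarrow> ring_parity M x q)"
proof -
  have ring: "f x = None" if "x \<in> grid M" "x \<notin> inner_grid M" for x
    using f that by (auto simp: grid_labelling_def)
  define good where
    "good x S q \<longleftrightarrow> route S x q \<and> S \<subseteq> grid M \<and> layered_labels f layer S \<and> (\<forall>y\<in>S. layer (f y) \<le> layer (f x))"
    for x S q
  have on_ring: "\<exists>S q. good x S q \<and> ring_parity M x q" if "x \<in> grid M - inner_grid M" for x
  proof -
    obtain S q where S: "route S x q" "S \<subseteq> grid M - inner_grid M" "ring_parity M x q"
      using ring_route[OF \<open>x \<in> grid M - inner_grid M\<close>] by blast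
    then have "f y = None" if "y \<in> S" for y using S(2) ring that by blast
    then have "good x S q"
      using S ring \<open>x \<in> grid M - inner_grid M\<close> by (auto simp: good_def layered_labels_def)
    then show ?thesis using S by blast
  qed
  have same: "\<exists>S q. good y S q" if "\<exists>S q. good x S q" "y \<in> grid M" "grid_adj x y" "f x = f y" for x y
  proof -
    from that obtain S q where S: "good x S q" by auto
    have "x \<in> S" using S route_end unfolding good_def by blast
    then have "good y (insert y S) (\<lambda>z. q z \<noteq> crosses z y x)"
      unfolding good_def
    proof (intro conjI)
      show "route (insert y S) y (\<lambda>z. q z \<noteq> crosses z y x)"
        using S \<open>grid_adj x y\<close> grid_adj_commute[of x y] unfolding good_def by (blast intro: route.step)
    qed (use S \<open>x \<in> S\<close> \<open>y \<in> grid M\<close> \<open>f x = f y\<close> in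
        \<open>simp_all add: good_def layered_labels_def, metis\<close>)
    then show ?thesis by blast
  qed
  have "\<exists>S q. good x S q" if "x \<in> grid M" "layer (f x) = d" for x d
    using that
  proof (induction d arbitrary: x)
    case 0
    have *: "\<exists>S q. good (i, j) S q" if "(i, j) \<in> grid M" "f (i, j) = None" for i j
      using that
    proof (induction i)
      case 0
      then show ?case using on_ring[of "(0, j)"] by (auto simp: grid_def inner_grid_def)
    next
      case (Suc i)
      show ?case
      proof (cases "(Suc i, j) \<in> inner_grid M")
        case True
        then have i: "f (i, j) = None" "(i, j) \<in> grid M"
          using f Suc.prems by (auto simp: grid_labelling_def grid_def)
        show ?thesis
          by (rule same[OF Suc.IH[OF i(2,1)]]) (use Suc.prems i in \<open>auto simp: grid_adj_def up_adj_def\<close>)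
      next
        case False
        then show ?thesis using on_ring[of "(Suc i, j)"] Suc.prems by blast
      qed
    qed
    show ?case using *[of "fst x" "snd x"] 0 zero by simp
  next
    case (Suc d)
    then obtain b where b: "(f x, b) \<in> contact M f" "layer b = d" using down by blast
    then obtain x' y' where xy: "f x' = f x" "f y' = b" "x' \<in> grid M" "y' \<in> grid M" "grid_adj x' y'"
      unfolding contact_def by auto
    then obtain S q where S: "good y' S q" using Suc.IH[of y'] b by auto
    have "good x' (insert x' S) (\<lambda>z. q z \<noteq> crosses z x' y')"
    proof -
      have "layer (f z) \<le> d" if "z \<in> S" for z using S that xy b by (auto simp: good_def)
      then have le: "layer (f z) \<le> layer (f x')" "layer (f z) \<noteq> layer (f x')" if "z \<in> S" for z
        using that Suc.prems xy(1) by fastforce+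
      show ?thesis
        unfolding good_def
      proof (intro conjI)
        show "route (insert x' S) x' (\<lambda>z. q z \<noteq> crosses z x' y')"
          using S xy(5) unfolding good_def by (blast intro: route.step)
        show "insert x' S \<subseteq> grid M" using S xy(3) unfolding good_def by blast
        show "layered_labels f layer (insert x' S)"
          unfolding layered_labels_def
        proof (intro ballI impI)
          fix y z assume "y \<in> insert x' S" "z \<in> insert x' S" "layer (f y) = layer (f z)"
          moreover have "layered_labels f layer S" using S unfolding good_def by blast
          ultimately show "f y = f z" using le(2)[of y] le(2)[of z] unfolding layered_labels_def by auto
        qed
        show "\<forall>y\<in>insert x' S. layer (f y) \<le> layer (f x')" using le(1) by blast
      qed
    qed
    then have start: "\<exists>S q. good x' S q" by blast
    obtain v where v: "f x = Some v"
      using Suc.prems zero[of x] by (cases "f x") auto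
    have "grid_connected {z \<in> grid M. f z = Some v}"
      using f by (auto simp: grid_labelling_def)
    then show ?case
      by (rule grid_connected_induct[where x = x' and P = "\<lambda>x. \<exists>S q. good x S q"])
        (use start same xy v Suc.prems in auto)
  qed
  then show ?thesis
    using on_ring[of x] \<open>x \<in> grid M\<close> unfolding good_def by (cases "x \<in> inner_grid M") blast+
qed

text \<open>
  \<open>Z\<close> splits the remaining vertices into two sides without edges between them, and takes at most
  two vertices of each layer.  Only the part \<open>U\<close> of the graph has to be balanced; \<open>Z\<close> may
  use vertices outside \<open>U\<close>.
\<close>
definition layered_separator ::
  "('a \<times> 'a) set \<Rightarrow> ('a \<Rightarrow> nat) \<Rightarrow> 'a set \<Rightarrow> 'a set \<Rightarrow> ('a \<Rightarrow> bool) \<Rightarrow> bool" where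
  "layered_separator E layer U Z side \<longleftrightarrow>
     (\<forall>k. card {v \<in> Z. layer v = k} \<le> 2) \<and>
     (\<forall>(u, v)\<in>E. u \<notin> Z \<longrightarrow> v \<notin> Z \<longrightarrow> side u = side v) \<and>
     (\<forall>b. 3 * card {u \<in> U - Z. side u = b} \<le> 2 * card U)"

definition has_layered_separators :: "('a \<times> 'a) set \<Rightarrow> 'a set \<Rightarrow> ('a \<Rightarrow> nat) \<Rightarrow> bool" where
  "has_layered_separators E V layer \<longleftrightarrow>
     (\<forall>(u, v)\<in>E. layer v \<le> Suc (layer u)) \<and>
     (\<forall>U\<subseteq>V. \<exists>Z side. Z \<subseteq> V \<and> layered_separator E layer U Z side)"

text \<open>
  The separator consists of the labels met by the two routes of \<open>balanced_route_pair\<close>.  Regions of other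
  labels are connected and avoid the routes, so each lies on one side, and touching regions
  lie on the same side.
\<close>
theorem grid_labelling_separators:
  fixes f :: "cell \<Rightarrow> 'a option"
  assumes f: "grid_labelling M f" and "M > 0" "finite V"
    and onto: "\<And>v. v \<in> V \<Longrightarrow> \<exists>x\<in>grid M. f x = Some v"
    and E: "\<And>u v. (u, v) \<in> E \<Longrightarrow> u \<in> V \<and> v \<in> V \<and> (Some u, Some v) \<in> contact M f"
  shows "\<exists>layer. has_layered_separators E V layer"
proof -
  have ring: "f x = None" if "x \<in> grid M" "x \<notin> inner_grid M" for x
    using f that by (auto simp: grid_labelling_def)
  have f0: "f (0, 0) = None" using ring[of "(0, 0)"] by (auto simp: grid_def inner_grid_def)
  from contact_layering[of M f] obtain layer where layer:
    "\<forall>x\<in>grid M. layer (f x) = 0 \<longleftrightarrow> f x = f (0, 0)"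
    "\<forall>a b. (a, b) \<in> contact M f \<longrightarrow> layer b \<le> Suc (layer a)"
    "\<forall>x\<in>grid M. \<forall>d. layer (f x) = Suc d \<longrightarrow> (\<exists>b. (f x, b) \<in> contact M f \<and> layer b = d)"
    by (elim exE conjE)
  have zero: "layer (f x) = 0 \<longleftrightarrow> f x = None" if "x \<in> grid M" for x
    using layer(1) that f0 by simp
  note up = layer(2)[rule_format] and down = layer(3)[rule_format]
  have "\<forall>x\<in>grid M. \<exists>S q. route S x q \<and> S \<subseteq> grid M \<and> layered_labels f layer S \<and>
      (x \<in> grid M - inner_grid M \<longrightarrow> ring_parity M x q)"
  proof
    fix x assume "x \<in> grid M"
    then have "\<exists>S q. route S x q \<and> S \<subseteq> grid M \<and> layered_labels f layer S \<and>
        (\<forall>y\<in>S. layer (f y) \<le> layer (f x)) \<and> (x \<in> grid M - inner_grid M \<longrightarrow> ring_parity M x q)"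
      by (intro layered_route[OF f]) (erule zero, erule (1) down, assumption)
    then show "\<exists>S q. route S x q \<and> S \<subseteq> grid M \<and> layered_labels f layer S \<and>
        (x \<in> grid M - inner_grid M \<longrightarrow> ring_parity M x q)"
      by (elim exE conjE) (intro exI conjI)
  qed
  then obtain S q where S: "\<And>x. x \<in> grid M \<Longrightarrow> route (S x) x (q x) \<and> S x \<subseteq> grid M \<and>
      layered_labels f layer (S x) \<and> (x \<in> grid M - inner_grid M \<longrightarrow> ring_parity M x (q x))"
    by metis
  define K where "K v = {x \<in> grid M. f x = Some v}" for v
  have conn: "grid_connected (K v)" for v using f by (simp add: grid_labelling_def K_def)
  obtain rep where rep: "\<And>v. v \<in> V \<Longrightarrow> rep v \<in> grid M \<and> f (rep v) = Some v"
    using onto by metis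
  have separator: "\<exists>Z side. Z \<subseteq> V \<and> layered_separator E (\<lambda>v. layer (Some v)) U Z side"
    if U: "U \<subseteq> V" for U
  proof -
    have "\<exists>x\<in>grid M. \<exists>y\<in>grid M. grid_adj x y \<and>
      (\<forall>b. 3 * card {u \<in> U. K u \<inter> (S x \<union> S y) = {} \<and> route_side x (q x) y (q y) (rep u) = b} \<le> 2 * card U)"
    proof (rule balanced_route_pair[OF \<open>M > 0\<close>])
      show "finite U" using U \<open>finite V\<close> finite_subset by blast
      show "rep u \<in> inner_grid M \<and> rep u \<in> K u" if "u \<in> U" for u
      proof -
        have "rep u \<in> grid M" "f (rep u) = Some u" using rep U that by auto
        then show ?thesis using ring[of "rep u"] by (cases "rep u \<in> inner_grid M") (auto simp: K_def)
      qed
    qed (use S in auto)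
    then obtain x y where xy: "x \<in> grid M" "y \<in> grid M" "grid_adj x y"
      and bal: "\<And>b. 3 * card {u \<in> U. K u \<inter> (S x \<union> S y) = {} \<and> route_side x (q x) y (q y) (rep u) = b} \<le> 2 * card U"
      by blast
    define Z where "Z = {v \<in> V. Some v \<in> f ` (S x \<union> S y)}"
    define sd where "sd u = route_side x (q x) y (q y) (rep u)" for u
    have Z: "u \<notin> Z \<longleftrightarrow> K u \<inter> (S x \<union> S y) = {}" if "u \<in> V" for u
    proof -
      have "S x \<union> S y \<subseteq> grid M" using S[OF xy(1)] S[OF xy(2)] by blast
      then show ?thesis using \<open>u \<in> V\<close> unfolding Z_def K_def by (force simp: image_iff)
    qed
    have const_side: "route_side x (q x) y (q y) c = sd u" if "u \<in> V" "u \<notin> Z" "c \<in> K u" for u c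
    proof (rule grid_connected_induct[OF conn[of u], where x = "rep u"])
      show "rep u \<in> K u" using rep[OF \<open>u \<in> V\<close>] by (simp add: K_def)
      fix c d assume "c \<in> K u" "d \<in> K u" "grid_adj c d" "route_side x (q x) y (q y) c = sd u"
      moreover have "{c, d} \<inter> (S x \<union> S y) = {}"
        using \<open>u \<notin> Z\<close> \<open>c \<in> K u\<close> \<open>d \<in> K u\<close> Z[OF \<open>u \<in> V\<close>] by blast
      ultimately show "route_side x (q x) y (q y) d = sd u"
        using route_side_neighbour[of "S x" x "q x" "S y" y "q y" c d] S xy by auto
    qed (use that in \<open>auto simp: sd_def\<close>)
    have "sd u = sd v" if uv: "(u, v) \<in> E" "u \<notin> Z" "v \<notin> Z" for u v
    proof -
      obtain c d where cd: "c \<in> K u" "d \<in> K v" "grid_adj c d"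
        using E[OF uv(1)] unfolding contact_def K_def by auto
      then have "{c, d} \<inter> (S x \<union> S y) = {}" using uv(2,3) Z[of u] Z[of v] E[OF uv(1)] by blast
      then have "route_side x (q x) y (q y) c = route_side x (q x) y (q y) d"
        using route_side_neighbour[of "S x" x "q x" "S y" y "q y" c d] S xy cd by auto
      then show ?thesis using const_side[of u c] const_side[of v d] uv cd E[OF uv(1)] by auto
    qed
    moreover have "card {v \<in> Z. layer (Some v) = k} \<le> 2" for k
    proof -
      have one: "\<exists>a. {v. Some v \<in> f ` S w \<and> layer (Some v) = k} \<subseteq> {a}" if "w \<in> grid M" for w
      proof (cases "{v. Some v \<in> f ` S w \<and> layer (Some v) = k} = {}")
        case False
        then obtain a where a: "Some a \<in> f ` S w" "layer (Some a) = k" by auto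
        have "v = a" if "Some v \<in> f ` S w" "layer (Some v) = k" for v
          using a that S[OF \<open>w \<in> grid M\<close>] unfolding layered_labels_def
          by (metis imageE option.inject)
        then show ?thesis by blast
      qed auto
      obtain a b where "{v. Some v \<in> f ` S x \<and> layer (Some v) = k} \<subseteq> {a}"
        "{v. Some v \<in> f ` S y \<and> layer (Some v) = k} \<subseteq> {b}"
        using one[OF xy(1)] one[OF xy(2)] by blast
      then have "{v \<in> Z. layer (Some v) = k} \<subseteq> {a, b}" unfolding Z_def by auto
      then have "card {v \<in> Z. layer (Some v) = k} \<le> card {a, b}" by (intro card_mono) auto
      also have "card {a, b} \<le> 2" by (cases "a = b") auto
      finally show ?thesis .
    qed
    moreover have "3 * card {u \<in> U - Z. sd u = b} \<le> 2 * card U" for b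
    proof -
      have "{u \<in> U - Z. sd u = b} = {u \<in> U. K u \<inter> (S x \<union> S y) = {} \<and> route_side x (q x) y (q y) (rep u) = b}"
        using Z U by (auto simp: sd_def)
      then show ?thesis using bal by simp
    qed
    ultimately have "layered_separator E (\<lambda>v. layer (Some v)) U Z sd"
      unfolding layered_separator_def by blast
    moreover have "Z \<subseteq> V" by (auto simp: Z_def)
    ultimately show ?thesis by blast
  qed
  have "layer (Some v) \<le> Suc (layer (Some u))" if "(u, v) \<in> E" for u v
    using up E[OF that] by blast
  then have "has_layered_separators E V (\<lambda>v. layer (Some v))"
    unfolding has_layered_separators_def
    using separator by blast
  then show ?thesis by blast
qed

section \<open>Recursive separation\<close>

lemma shrinking_two_thirds:
  assumes "(3/2) ^ d \<le> real m" "3 * m \<le> 2 * n"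
  shows "(3/2) ^ Suc d \<le> real n"
proof -
  have "3 * real m \<le> 2 * real n" using assms(2) by linarith
  then show ?thesis using assms(1) by simp
qed

definition edge_connected :: "('a \<times> 'a) set \<Rightarrow> 'a set \<Rightarrow> bool" where
  "edge_connected E W \<longleftrightarrow>
     (\<forall>P. (\<exists>w\<in>W. P w) \<longrightarrow> (\<forall>u\<in>W. \<forall>v\<in>W. (u, v) \<in> E \<longrightarrow> P u = P v) \<longrightarrow> (\<forall>w\<in>W. P w))"

text \<open>
  The property of levels \<open>depth\<close> and bits \<open>lab\<close> that makes the colouring work: in a connected set,
  vertices of minimal level are determined by their layer and bit.
\<close>
definition separates_ties ::
  "('a \<times> 'a) set \<Rightarrow> ('a \<Rightarrow> nat) \<Rightarrow> 'a set \<Rightarrow> ('a \<Rightarrow> nat) \<Rightarrow> ('a \<Rightarrow> bool) \<Rightarrow> bool" where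
  "separates_ties E layer U depth lab \<longleftrightarrow>
     (\<forall>W u v. W \<subseteq> U \<longrightarrow> edge_connected E W \<longrightarrow> u \<in> W \<longrightarrow> v \<in> W \<longrightarrow> (\<forall>w\<in>W. depth u \<le> depth w) \<longrightarrow>
        depth u = depth v \<longrightarrow> layer u = layer v \<longrightarrow> lab u = lab v \<longrightarrow> u = v)"

text \<open>
  Level \<open>0\<close> is the separator of \<open>U\<close>, and the two sides are treated recursively.  A connected
  set either meets the separator, and then its vertices of minimal level belong to it, or lies on one
  side.  The bit marks one chosen vertex of the separator in each layer.
\<close>
lemma separator_hierarchy:
  assumes sep: "has_layered_separators E V layer" and "finite V" "U \<subseteq> V"
  shows "\<exists>depth lab. (\<forall>u\<in>U. (3/2) ^ depth u \<le> real (card U)) \<and> separates_ties E layer U depth lab"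
  using \<open>U \<subseteq> V\<close>
proof (induction "card U" arbitrary: U rule: less_induct)
  case less
  have finU: "finite U" using less.prems \<open>finite V\<close> finite_subset by blast
  show ?case
  proof (cases "U = {}")
    case True
    then show ?thesis by (auto simp: separates_ties_def)
  next
    case False
    obtain Z side where "Z \<subseteq> V" and Z: "layered_separator E layer U Z side"
      using sep less.prems unfolding has_layered_separators_def by blast
    have two: "card {v \<in> Z. layer v = k} \<le> 2" for k
      using Z by (simp add: layered_separator_def)
    have const: "side u = side v" if "(u, v) \<in> E" "u \<notin> Z" "v \<notin> Z" for u v
      using Z that by (auto simp: layered_separator_def)
    have bal: "3 * card {u \<in> U - Z. side u = b} \<le> 2 * card U" for b
      using Z by (simp add: layered_separator_def)
    define part where "part b = {u \<in> U - Z. side u = b}" for b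
    have small: "card (part b) < card U" for b
    proof -
      have "card U > 0" using False finU by (simp add: card_gt_0_iff)
      then show ?thesis using bal[of b] unfolding part_def by linarith
    qed
    have sub: "part b \<subseteq> V" for b using less.prems by (auto simp: part_def)
    have "\<forall>b. \<exists>depth lab. (\<forall>u\<in>part b. (3/2) ^ depth u \<le> real (card (part b))) \<and>
        separates_ties E layer (part b) depth lab"
      using less.hyps[OF small sub] by blast
    then obtain depth lab where depth: "\<And>b u. u \<in> part b \<Longrightarrow> (3/2) ^ depth b u \<le> real (card (part b))"
      and lab: "\<And>b. separates_ties E layer (part b) (depth b) (lab b)"
      by metis
    have "\<exists>l :: 'a \<Rightarrow> bool. \<forall>u\<in>U \<inter> Z. \<forall>v\<in>U \<inter> Z. layer u = layer v \<longrightarrow> l u = l v \<longrightarrow> u = v"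
    proof -
      define fst_of where "fst_of k = (SOME v. v \<in> U \<inter> Z \<and> layer v = k)" for k
      have "u = v" if uv: "u \<in> U \<inter> Z" "v \<in> U \<inter> Z" "layer u = layer v"
        "(u = fst_of (layer u)) = (v = fst_of (layer v))" for u v
      proof (rule ccontr)
        assume "u \<noteq> v"
        define w where "w = fst_of (layer u)"
        have w: "w \<in> U \<inter> Z \<and> layer w = layer u"
          unfolding w_def fst_of_def by (rule someI[of _ u]) (use uv in auto)
        have "u \<noteq> w" "v \<noteq> w" using uv \<open>u \<noteq> v\<close> by (auto simp: w_def)
        then have "card {u, v, w} = 3" using \<open>u \<noteq> v\<close> by auto
        moreover have "{u, v, w} \<subseteq> {x \<in> U \<inter> Z. layer x = layer u}" using uv w by auto
        moreover have "finite {x \<in> U \<inter> Z. layer x = layer u}" using finU by auto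
        ultimately have "3 \<le> card {x \<in> U \<inter> Z. layer x = layer u}" by (metis card_mono)
        moreover have "card {x \<in> U \<inter> Z. layer x = layer u} \<le> card {x \<in> Z. layer x = layer u}"
          by (rule card_mono) (use finite_subset[OF \<open>Z \<subseteq> V\<close> \<open>finite V\<close>] in auto)
        ultimately show False using two[of "layer u"] by linarith
      qed
      then show ?thesis by (intro exI[of _ "\<lambda>u. u = fst_of (layer u)"]) blast
    qed
    then obtain l :: "'a \<Rightarrow> bool" where l: "\<And>u v. u \<in> U \<inter> Z \<Longrightarrow> v \<in> U \<inter> Z \<Longrightarrow> layer u = layer v \<Longrightarrow> l u = l v \<Longrightarrow> u = v"
      by blast
    define D where "D u = (if u \<in> Z then 0 else Suc (depth (side u) u))" for u
    define L where "L u = (if u \<in> Z then l u else lab (side u) u)" for u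
    have "(3/2) ^ D u \<le> real (card U)" if "u \<in> U" for u
    proof (cases "u \<in> Z")
      case True
      then show ?thesis using False finU by (simp add: D_def Suc_le_eq card_gt_0_iff)
    next
      case False
      then have "u \<in> part (side u)" using that by (simp add: part_def)
      from shrinking_two_thirds[OF depth[OF this] bal[of "side u", folded part_def]]
      show ?thesis using False by (simp only: D_def if_False)
    qed
    moreover have "separates_ties E layer U D L"
      unfolding separates_ties_def
    proof (intro allI impI)
      fix W u v
      assume W: "W \<subseteq> U" "edge_connected E W" and uv: "u \<in> W" "v \<in> W" "\<forall>w\<in>W. D u \<le> D w"
        "D u = D v" "layer u = layer v" "L u = L v"
      show "u = v"
      proof (cases "W \<inter> Z = {}")
        case True
        have same: "\<forall>w\<in>W. side w = side u"
          using W(2)[unfolded edge_connected_def, rule_format, of "\<lambda>w. side w = side u"] const True uv(1)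
          by blast
        have "W \<subseteq> part (side u)" using W(1) True same unfolding part_def by blast
        moreover have "\<forall>w\<in>W. depth (side u) u \<le> depth (side u) w"
        proof
          fix w assume "w \<in> W"
          then have "u \<notin> Z" "w \<notin> Z" "side w = side u" using True same uv(1) by blast+
          then show "depth (side u) u \<le> depth (side u) w"
            using uv(3) \<open>w \<in> W\<close> by (auto simp: D_def)
        qed
        moreover have "u \<notin> Z" "v \<notin> Z" "side v = side u" using True same uv(1,2) by blast+
        then have "depth (side u) u = depth (side u) v" "lab (side u) u = lab (side u) v"
          using uv(4,6) by (simp_all add: D_def L_def)
        ultimately show ?thesis
          using lab[of "side u"] W(2) uv(1,2,5) unfolding separates_ties_def by blast
      next
        case False
        then obtain w where "w \<in> W" "w \<in> Z" by auto
        then have "D w = 0" by (simp add: D_def)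
        then have "D u = 0" "D v = 0" using uv(3,4) \<open>w \<in> W\<close> by auto
        then have "u \<in> Z" "v \<in> Z" by (auto simp: D_def split: if_splits)
        then show ?thesis using l[of u v] W(1) uv by (auto simp: L_def)
      qed
    qed
    ultimately show ?thesis by blast
  qed
qed

section \<open>Colouring a graph with layered separators\<close>

lemma nth_vwalk_arcs: "Suc i < length vs \<Longrightarrow> (vs ! i, vs ! Suc i) \<in> set (vwalk_arcs vs)"
proof (induction vs arbitrary: i rule: vwalk_arcs.induct)
  case (3 x y xs)
  then show ?case by (cases i) auto
qed auto

lemma edge_connected_vwalk:
  assumes "vwalk vs (with_proj G)"
  shows "edge_connected (parcs G) (set vs)"
  unfolding edge_connected_def
proof (intro allI impI)
  fix P assume ex: "\<exists>w\<in>set vs. P w" and inv: "\<forall>u\<in>set vs. \<forall>v\<in>set vs. (u, v) \<in> parcs G \<longrightarrow> P u = P v"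
  have "P (vs ! i) = P (vs ! 0)" if "i < length vs" for i
    using that
  proof (induction i)
    case (Suc i)
    then have "(vs ! i, vs ! Suc i) \<in> parcs G"
      using nth_vwalk_arcs[of i vs] assms by (auto simp: vwalk_def)
    moreover have "vs ! i \<in> set vs" "vs ! Suc i \<in> set vs" using Suc.prems by auto
    ultimately have "P (vs ! i) = P (vs ! Suc i)" using inv by blast
    then show ?case using Suc by simp
  qed simp
  then show "\<forall>w\<in>set vs. P w" using ex by (metis in_set_conv_nth)
qed

text \<open>The colour encodes level, layer colour and bit as one number; each level takes eight colours.\<close>
theorem nonrepetitive_of_layered_separators:
  assumes "pair_graph G" "pverts G \<noteq> {}"
    and sep: "has_layered_separators (parcs G) (pverts G) layer"
  shows "\<exists>k \<psi>. k_colouring G k \<psi> \<and> nonrepetitive G \<psi> \<and>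
    real k \<le> 8 * (1 + log (3/2) (real (card (pverts G))))"
proof -
  interpret pair_graph G by fact
  have lay: "layer v \<le> Suc (layer u)" if "(u, v) \<in> parcs G" for u v
    using sep that unfolding has_layered_separators_def by blast
  define n where "n = card (pverts G)"
  have n: "n \<ge> 1" using assms(2) pair_finite_verts by (simp add: n_def Suc_le_eq card_gt_0_iff)
  obtain depth lab where depth: "\<And>u. u \<in> pverts G \<Longrightarrow> (3/2) ^ depth u \<le> real n"
    and ties: "separates_ties (parcs G) layer (pverts G) depth lab"
    using separator_hierarchy[OF sep pair_finite_verts order_refl] unfolding n_def by blast
  define D where "D = nat \<lfloor>log (3/2) (real n)\<rfloor>"
  have log: "log (3/2) (real n) \<ge> 0" using n by simp
  have depth_le: "depth u \<le> D" if "u \<in> pverts G" for u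
    using le_log_of_power[OF depth[OF that]] by (simp add: D_def le_nat_floor)
  define \<psi> where "\<psi> u = 8 * depth u + (2 * path_colour (layer u) + of_bool (lab u))" for u
  have less8: "2 * path_colour (layer u) + of_bool (lab u) < 8" for u
    using path_colour_less[of "layer u"] by auto
  have decode: "depth u = depth v \<and> path_colour (layer u) = path_colour (layer v) \<and> lab u = lab v"
    if "\<psi> u = \<psi> v" for u v
  proof -
    have "depth u = depth v"
      using that less8[of u] less8[of v] unfolding \<psi>_def by linarith
    moreover from this
    have "2 * path_colour (layer u) + of_bool (lab u) = 2 * path_colour (layer v) + (of_bool (lab v) :: nat)"
      using that unfolding \<psi>_def by simp
    ultimately show ?thesis by (cases "lab u"; cases "lab v"; simp; presburger)
  qed
  have "k_colouring G (8 * (D + 1)) \<psi>"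
    unfolding k_colouring_def
  proof clarify
    fix u assume "u \<in> pverts G"
    then show "\<psi> u < 8 * (D + 1)" using depth_le[of u] less8[of u] by (simp add: \<psi>_def)
  qed
  moreover have "nonrepetitive G \<psi>"
    unfolding nonrepetitive_def
  proof (intro allI impI notI)
    fix vs assume path: "vpath vs (with_proj G)" and "repetitively_coloured \<psi> vs"
    then obtain t where t: "t \<ge> 1" "length vs = 2 * t" "\<And>i. i < t \<Longrightarrow> \<psi> (vs ! i) = \<psi> (vs ! (t + i))"
      unfolding repetitively_coloured_def by blast
    have vs: "vwalk vs (with_proj G)" "distinct vs" "set vs \<subseteq> pverts G"
      using path by (auto simp: vpath_def vwalk_def)
    have colours: "path_colour (layer (vs ! i)) = path_colour (layer (vs ! (t + i)))" if "i < t" for i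
      using decode[OF t(3)[OF that]] by blast
    have "layer (vs ! i) = layer (vs ! (t + i))" if "i < t" for i
    proof (rule repetitive_lazy_walk[where v = "\<lambda>i. layer (vs ! i)" and t = t])
      fix i assume "Suc i < 2 * t"
      then have "(vs ! i, vs ! Suc i) \<in> parcs G"
        using nth_vwalk_arcs[of i vs] vs(1) t(2) by (auto simp: vwalk_def)
      moreover from this have "(vs ! Suc i, vs ! i) \<in> parcs G" by (rule arcs_symmetric)
      ultimately show "layer (vs ! Suc i) \<le> layer (vs ! i) + 1 \<and> layer (vs ! i) \<le> layer (vs ! Suc i) + 1"
        using lay by simp
    qed (use that colours in blast)+
    then have partner: "depth (vs ! i) = depth (vs ! (t + i)) \<and> layer (vs ! i) = layer (vs ! (t + i)) \<and>
        lab (vs ! i) = lab (vs ! (t + i))" if "i < t" for i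
      using decode[OF t(3)[OF that]] that by blast
    define u where "u = arg_min_on depth (set vs)"
    have "set vs \<noteq> {}" using t by auto
    then have u: "u \<in> set vs" "\<And>w. w \<in> set vs \<Longrightarrow> depth u \<le> depth w"
      unfolding u_def using arg_min_if_finite[of "set vs" depth] by (auto simp: not_less)
    then obtain i where i: "i < 2 * t" "vs ! i = u" using t(2) by (metis in_set_conv_nth)
    obtain j where j: "j < 2 * t" "j \<noteq> i" "depth u = depth (vs ! j)" "layer u = layer (vs ! j)" "lab u = lab (vs ! j)"
    proof (cases "i < t")
      case True
      then show ?thesis using that[of "t + i"] partner[of i] i t(1) by auto
    next
      case False
      then show ?thesis using that[of "i - t"] partner[of "i - t"] i t(1) by auto
    qed
    have "u = vs ! j"
      using ties[unfolded separates_ties_def, rule_format, of "set vs" u "vs ! j"] vs(3)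
        edge_connected_vwalk[OF vs(1)] u j t(2) by auto
    then show False using i j vs(2) t(2) by (metis nth_eq_iff_index_eq)
  qed
  moreover have "real (8 * (D + 1)) \<le> 8 * (1 + log (3/2) (real n))"
  proof -
    have "real D \<le> log (3/2) (real n)" using log by (simp add: D_def of_nat_floor)
    then show ?thesis by simp
  qed
  ultimately show ?thesis unfolding n_def by blast
qed

section \<open>Rasterising plane sets\<close>

text \<open>
  The shift by \<open>K\<close> makes the coordinates of the points under consideration nonnegative.  The cells are
  half-open squares, closed to the left and below.  Two of them are adjacent in the
  triangulated grid iff one contains a point of the closure of the other; in particular the falling
  diagonals are not adjacent, since the common corner belongs to a third square.
\<close>
definition cell_of :: "nat \<Rightarrow> nat \<Rightarrow> complex \<Rightarrow> cell" where
  "cell_of N K z = (nat \<lfloor>real N * (Re z + real K)\<rfloor>, nat \<lfloor>real N * (Im z + real K)\<rfloor>)"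

lemma nat_floor_near:
  fixes r :: real
  shows "\<forall>\<^sub>F s in nhds r. nat \<lfloor>s\<rfloor> = nat \<lfloor>r\<rfloor> \<or> Suc (nat \<lfloor>s\<rfloor>) = nat \<lfloor>r\<rfloor>"
proof -
  have "\<forall>\<^sub>F s in nhds r. r - 1 < s \<and> s < of_int (\<lfloor>r\<rfloor> + 1)"
    by (intro eventually_conj order_tendstoD[OF filterlim_ident]) linarith+
  then show ?thesis
  proof eventually_elim
    case (elim s)
    then have "\<lfloor>s\<rfloor> = \<lfloor>r\<rfloor> \<or> \<lfloor>s\<rfloor> = \<lfloor>r\<rfloor> - 1" by linarith
    then show ?case by auto
  qed
qed

text \<open>Near a point, rounding down can only decrease the coordinates of its cell, by at most one.\<close>
lemma cell_of_near:
  "\<forall>\<^sub>F w in nhds z. cell_of N K w = cell_of N K z \<or> grid_adj (cell_of N K w) (cell_of N K z)"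
proof -
  have re: "((\<lambda>w. real N * (Re w + real K)) \<longlongrightarrow> real N * (Re z + real K)) (nhds z)"
    and im: "((\<lambda>w. real N * (Im w + real K)) \<longlongrightarrow> real N * (Im z + real K)) (nhds z)"
    by (intro tendsto_intros filterlim_ident)+
  show ?thesis
    using eventually_compose_filterlim[OF nat_floor_near re] eventually_compose_filterlim[OF nat_floor_near im]
  proof eventually_elim
    case (elim w)
    have "(a, b) = (c, d) \<or> grid_adj (a, b) (c, d)" if "a = c \<or> Suc a = c" "b = d \<or> Suc b = d" for a b c d
      using that by (auto simp: grid_adj_def up_adj_def)
    from this[OF elim] show ?case unfolding cell_of_def .
  qed
qed

lemma grid_connected_cell_of:
  assumes "connected X"
  shows "grid_connected (cell_of N K ` X)"
  unfolding grid_connected_def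
proof (intro allI impI)
  fix A assume A: "A \<subseteq> cell_of N K ` X" "A \<noteq> {}"
    and closed: "\<forall>x\<in>A. \<forall>y\<in>cell_of N K ` X. grid_adj x y \<longrightarrow> y \<in> A"
  then obtain a where a: "a \<in> X" "cell_of N K a \<in> A" by blast
  have "cell_of N K b \<in> A" if "b \<in> X" for b
  proof (rule connected_induction_simple[OF assms a(1) that, where P = "\<lambda>z. cell_of N K z \<in> A"])
    fix z assume "z \<in> X"
    obtain S where S: "open S" "z \<in> S"
      "\<And>w. w \<in> S \<Longrightarrow> cell_of N K w = cell_of N K z \<or> grid_adj (cell_of N K w) (cell_of N K z)"
      using cell_of_near[of N K z] unfolding eventually_nhds by blast
    have iff: "cell_of N K w \<in> A \<longleftrightarrow> cell_of N K z \<in> A" if w: "w \<in> X \<inter> S" for w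
    proof -
      have "cell_of N K w \<in> cell_of N K ` X" "cell_of N K z \<in> cell_of N K ` X"
        using \<open>z \<in> X\<close> w by blast+
      then show ?thesis
        using S(3)[of w] closed w grid_adj_commute[of "cell_of N K w" "cell_of N K z"] by auto
    qed
    have "openin (top_of_set X) (X \<inter> S)" using S(1) by (rule openin_open_Int)
    then show "\<exists>T. openin (top_of_set X) T \<and> z \<in> T \<and>
        (\<forall>x\<in>T. \<forall>y\<in>T. cell_of N K x \<in> A \<longrightarrow> cell_of N K y \<in> A)"
      using S(2) \<open>z \<in> X\<close> iff by blast
  qed (use a in auto)
  then show "A = cell_of N K ` X" using A by blast
qed

text \<open>Disjoint compact sets have positive distance, which exceeds the diameter of the cells of a fine grid.\<close>
lemma cell_of_separates:
  assumes "compact A" "compact B" "A \<inter> B = {}"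
    and bound: "\<And>z. z \<in> A \<union> B \<Longrightarrow> cmod z \<le> real K"
  shows "\<forall>\<^sub>F N in sequentially. cell_of N K ` A \<inter> cell_of N K ` B = {}"
proof -
  obtain d where d: "d > 0" "\<And>a b. a \<in> A \<Longrightarrow> b \<in> B \<Longrightarrow> d \<le> dist a b"
    using separate_compact_closed[OF assms(1) compact_imp_closed[OF assms(2)] assms(3)] by blast
  have "\<forall>\<^sub>F N in sequentially. 2 / d < real N"
    using filterlim_real_sequentially by (simp add: filterlim_at_top_dense)
  then show ?thesis
  proof eventually_elim
    case (elim N)
    have N: "real N > 0" using elim d(1) by (meson divide_pos_pos less_trans zero_less_numeral)
    have close: "\<bar>x - y\<bar> < 1 / N"
      if "nat \<lfloor>real N * (x + real K)\<rfloor> = nat \<lfloor>real N * (y + real K)\<rfloor>" "\<bar>x\<bar> \<le> real K" "\<bar>y\<bar> \<le> real K" for x y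
    proof -
      have "real N * (x + real K) \<ge> 0" "real N * (y + real K) \<ge> 0" using that N by auto
      then have "\<bar>real N * (x + real K) - real N * (y + real K)\<bar> < 1" using that(1) by linarith
      then have "real N * \<bar>x - y\<bar> < 1" using N by (simp add: right_diff_distrib[symmetric] abs_mult)
      then show ?thesis using N by (simp add: field_simps)
    qed
    show ?case
    proof (rule ccontr)
      assume "\<not> ?thesis"
      then obtain c where c: "c \<in> cell_of N K ` A" "c \<in> cell_of N K ` B" by blast
      from c(1) obtain a where a: "c = cell_of N K a" "a \<in> A" by (rule imageE)
      from c(2) obtain b where b: "c = cell_of N K b" "b \<in> B" by (rule imageE)
      note ab = a(2) b(2) a(1)[symmetric, unfolded b(1), symmetric]
      have le: "\<bar>Re z\<bar> \<le> real K" "\<bar>Im z\<bar> \<le> real K" if "z \<in> A \<union> B" for z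
        using bound[OF that] abs_Re_le_cmod[of z] abs_Im_le_cmod[of z] by auto
      have "\<bar>Re a - Re b\<bar> < 1 / N" "\<bar>Im a - Im b\<bar> < 1 / N"
        using ab le[of a] le[of b] by (intro close; simp add: cell_of_def)+
      moreover have "dist a b \<le> \<bar>Re a - Re b\<bar> + \<bar>Im a - Im b\<bar>"
        using cmod_le[of "a - b"] by (simp add: dist_norm)
      ultimately have "dist a b < 2 / N" by linarith
      also have "2 / N < d" using elim d(1) N by (simp add: field_simps)
      finally show False using d(2)[OF ab(1,2)] by linarith
    qed
  qed
qed

text \<open>
  Disjoint regions \<open>B v\<close> are enlarged along connected links \<open>Q (u, v)\<close> until the regions joined by
  a link touch.  The whole link is given to its first end, except for the cells of \<open>B v\<close> and those which
  are reachable only through \<open>B v\<close>; this keeps the regions connected and disjoint even if the link winds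
  through \<open>B v\<close> several times.
\<close>
lemma connect_along_links:
  fixes B :: "'a \<Rightarrow> cell set" and Q :: "'a \<times> 'a \<Rightarrow> cell set"
  assumes B: "\<And>v. v \<in> V \<Longrightarrow> grid_connected (B v)"
    and B_disj: "\<And>u v. u \<in> V \<Longrightarrow> v \<in> V \<Longrightarrow> u \<noteq> v \<Longrightarrow> B u \<inter> B v = {}"
    and E: "\<And>u v. (u, v) \<in> E \<Longrightarrow> u \<in> V \<and> v \<in> V \<and> u \<noteq> v"
    and Q: "\<And>e. e \<in> E \<Longrightarrow> grid_connected (Q e)"
    and Q_meets: "\<And>u v. (u, v) \<in> E \<Longrightarrow> Q (u, v) \<inter> B u \<noteq> {} \<and> Q (u, v) \<inter> B v \<noteq> {}"
    and Q_avoids: "\<And>u v w. (u, v) \<in> E \<Longrightarrow> w \<in> V \<Longrightarrow> w \<noteq> u \<Longrightarrow> w \<noteq> v \<Longrightarrow> Q (u, v) \<inter> B w = {}"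
    and Q_disj: "\<And>e e'. e \<in> E \<Longrightarrow> e' \<in> E \<Longrightarrow> e \<noteq> e' \<Longrightarrow> Q e \<inter> Q e' = {}"
  shows "\<exists>B'. (\<forall>v\<in>V. grid_connected (B' v) \<and> B v \<subseteq> B' v \<and> B' v \<subseteq> B v \<union> \<Union>(Q ` E)) \<and>
    (\<forall>u\<in>V. \<forall>v\<in>V. u \<noteq> v \<longrightarrow> B' u \<inter> B' v = {}) \<and>
    (\<forall>(u, v)\<in>E. \<exists>x\<in>B' u. \<exists>y\<in>B' v. grid_adj x y)"
proof -
  define D where "D u v = Q (u, v) - B v" for u v
  define R where
    "R u v = {y. \<exists>x\<in>Q (u, v) \<inter> B u. (x, y) \<in> {(a, b). a \<in> D u v \<and> b \<in> D u v \<and> grid_adj a b}\<^sup>*}" for u v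
  define B' where "B' u = B u \<union> (\<Union>v\<in>{v. (u, v) \<in> E}. R u v)" for u
  have start: "Q (u, v) \<inter> B u \<subseteq> R u v" for u v unfolding R_def by blast
  have R_D: "R u v \<subseteq> D u v" if uv: "(u, v) \<in> E" for u v
  proof
    fix y assume "y \<in> R u v"
    then obtain x where x: "x \<in> Q (u, v) \<inter> B u"
      "(x, y) \<in> {(a, b). a \<in> D u v \<and> b \<in> D u v \<and> grid_adj a b}\<^sup>*" unfolding R_def by blast
    have "x \<in> D u v" using x(1) B_disj[of u v] E[OF uv] unfolding D_def by blast
    with x(2) show "y \<in> D u v" by (induction rule: rtrancl_induct) auto
  qed
  have R_step: "y \<in> R u v" if "x \<in> R u v" "x \<in> D u v" "y \<in> D u v" "grid_adj x y" for x y u v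
    using that unfolding R_def by (blast intro: rtrancl_into_rtrancl)
  have touch: "\<exists>x\<in>R u v. \<exists>y\<in>B v. grid_adj x y" if uv: "(u, v) \<in> E" for u v
  proof (rule ccontr)
    assume no: "\<not> ?thesis"
    have "R u v = Q (u, v)"
    proof (rule Q[OF uv, unfolded grid_connected_def, rule_format])
      show "R u v \<subseteq> Q (u, v)" using R_D[OF uv] unfolding D_def by blast
      show "R u v \<noteq> {}" using start[of u v] Q_meets[OF uv] by blast
      fix x y assume xy: "x \<in> R u v" "y \<in> Q (u, v)" "grid_adj x y"
      then have "y \<in> D u v" using no unfolding D_def by blast
      then show "y \<in> R u v" using R_step[of x u v y] xy R_D[OF uv] by blast
    qed
    then show False using R_D[OF uv] Q_meets[OF uv] unfolding D_def by blast
  qed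
  have connected: "grid_connected (B' u)" if "u \<in> V" for u
    unfolding grid_connected_def
  proof (intro allI impI)
    fix A assume A: "A \<subseteq> B' u" "A \<noteq> {}" and closed: "\<forall>x\<in>A. \<forall>y\<in>B' u. grid_adj x y \<longrightarrow> y \<in> A"
    have along: "\<exists>x\<in>B u. y \<in> A \<longleftrightarrow> x \<in> A" if y: "y \<in> R u v" and uv: "(u, v) \<in> E" for y v
    proof -
      let ?r = "{(a, b). a \<in> D u v \<and> b \<in> D u v \<and> grid_adj a b}"
      obtain x where x: "x \<in> Q (u, v) \<inter> B u" "(x, y) \<in> ?r\<^sup>*" using y unfolding R_def by blast
      from x(2) have "y \<in> A \<longleftrightarrow> x \<in> A"
      proof (induction rule: rtrancl_induct)
        case (step y z)
        then have "y \<in> R u v" "z \<in> R u v"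
          using x(1) unfolding R_def by (blast intro: rtrancl_into_rtrancl)+
        then have "y \<in> B' u" "z \<in> B' u" using uv unfolding B'_def by blast+
        then show ?case using step closed grid_adj_commute by blast
      qed simp
      then show ?thesis using x(1) by blast
    qed
    have "A \<inter> B u \<noteq> {}" using A along unfolding B'_def by blast
    moreover have "\<forall>x\<in>A \<inter> B u. \<forall>y\<in>B u. grid_adj x y \<longrightarrow> y \<in> A \<inter> B u"
      using closed unfolding B'_def by blast
    ultimately have "A \<inter> B u = B u"
      using B[OF \<open>u \<in> V\<close>] unfolding grid_connected_def by blast
    then show "A = B' u" using A(1) along unfolding B'_def by blast
  qed
  have disjoint: "B' u \<inter> B' w = {}" if "u \<in> V" "w \<in> V" "u \<noteq> w" for u w
  proof -
    have RB: "R u v \<inter> B w = {}" if "(u, v) \<in> E" "w \<in> V" "u \<noteq> w" for u v w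
      using R_D[OF that(1)] Q_avoids[OF that(1,2)] that(3) unfolding D_def by blast
    have "R u v \<inter> R w v' = {}" if "(u, v) \<in> E" "(w, v') \<in> E" for v v'
      using R_D[OF that(1)] R_D[OF that(2)] Q_disj[OF that] \<open>u \<noteq> w\<close> unfolding D_def by blast
    then show ?thesis
      using RB[of u _ w] RB[of w _ u] B_disj[of u w] that unfolding B'_def by blast
  qed
  have "B' u \<subseteq> B u \<union> \<Union>(Q ` E)" for u
    using R_D unfolding B'_def D_def by blast
  moreover have "B u \<subseteq> B' u" for u unfolding B'_def by blast
  moreover have "\<exists>x\<in>B' u. \<exists>y\<in>B' v. grid_adj x y" if "(u, v) \<in> E" for u v
    using touch[OF that] that unfolding B'_def by blast
  ultimately show ?thesis using connected disjoint by (intro exI[of _ B']) blast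
qed

fun spread :: "(cell \<Rightarrow> 'b option) \<Rightarrow> 'b \<Rightarrow> nat \<Rightarrow> nat \<Rightarrow> 'b" where
  "spread seed l 0 j = l"
| "spread seed l (Suc i) j = (case seed (Suc i, j) of Some l' \<Rightarrow> l' | None \<Rightarrow> spread seed l i j)"

text \<open>Cells outside the given regions take over the label of their left neighbour.\<close>
lemma grid_labelling_of_regions:
  fixes B :: "'a \<Rightarrow> cell set"
  assumes conn: "\<And>v. v \<in> V \<Longrightarrow> grid_connected (B v)"
    and inside: "\<And>v. v \<in> V \<Longrightarrow> B v \<subseteq> inner_grid M"
    and disj: "\<And>u v. u \<in> V \<Longrightarrow> v \<in> V \<Longrightarrow> u \<noteq> v \<Longrightarrow> B u \<inter> B v = {}"
  shows "\<exists>f. grid_labelling M f \<and> (\<forall>v\<in>V. \<forall>x\<in>B v. f x = Some v)"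
proof -
  define seed :: "cell \<Rightarrow> 'a option option" where
    "seed x = (if x \<notin> inner_grid M then Some None
      else if \<exists>v\<in>V. x \<in> B v then Some (Some (THE v. v \<in> V \<and> x \<in> B v)) else None)" for x
  define f where "f x = spread seed None (fst x) (snd x)" for x
  have seed_B: "seed x = Some (Some v)" if "v \<in> V" "x \<in> B v" for x v
  proof -
    have "(THE v. v \<in> V \<and> x \<in> B v) = v" using that disj by (intro the_equality) blast+
    then show ?thesis using that inside unfolding seed_def by auto
  qed
  have seed_D: "v \<in> V \<and> x \<in> B v" if x: "seed x = Some (Some v)" for x v
  proof -
    obtain w where w: "w \<in> V" "x \<in> B w"
      using x unfolding seed_def by (auto split: if_splits)
    then show ?thesis using seed_B[OF w] x by simp
  qed
  have f_seed: "f x = l" if "seed x = Some l" "x \<in> grid M" for x l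
  proof (cases "fst x")
    case 0
    then have "x \<notin> inner_grid M" by (auto simp: inner_grid_def)
    then show ?thesis using that 0 by (simp add: f_def seed_def)
  next
    case (Suc i)
    then have "x = (Suc i, snd x)" by (simp add: prod_eq_iff)
    then show ?thesis using that Suc unfolding f_def by (metis spread.simps(2) option.simps(5))
  qed
  have f_none: "\<exists>i. fst x = Suc i \<and> f x = f (i, snd x)" if "seed x = None" for x
  proof -
    have "x \<in> inner_grid M" using that by (auto simp: seed_def split: if_splits)
    then obtain i where "fst x = Suc i" by (cases "fst x") (auto simp: inner_grid_def)
    moreover from this have "x = (Suc i, snd x)" by (simp add: prod_eq_iff)
    ultimately show ?thesis using that by (auto simp: f_def)
  qed
  have B: "f x = Some v" if "v \<in> V" "x \<in> B v" for x v
    using f_seed[OF seed_B[OF that]] inside[OF that(1)] that(2)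
    by (auto simp: grid_def inner_grid_def)
  have fibre: "grid_connected {x \<in> grid M. f x = Some v}" (is "grid_connected ?F") for v
    unfolding grid_connected_def
  proof (intro allI impI)
    fix A assume A: "A \<subseteq> ?F" "A \<noteq> {}" and closed: "\<forall>x\<in>A. \<forall>y\<in>?F. grid_adj x y \<longrightarrow> y \<in> A"
    have hit: "\<exists>y. v \<in> V \<and> y \<in> B v \<and> (x \<in> A \<longleftrightarrow> y \<in> A)" if "x \<in> ?F" for x
      using that
    proof (induction "fst x" arbitrary: x)
      case 0
      then have "seed x = Some None" by (auto simp: seed_def inner_grid_def)
      then show ?case using f_seed[of x] 0 by auto
    next
      case (Suc i)
      show ?case
      proof (cases "seed x")
        case None
        then have y: "(i, snd x) \<in> ?F" "grid_adj x (i, snd x)"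
          using f_none[OF None] Suc.hyps(2) Suc.prems
          by (auto simp: grid_def grid_adj_def up_adj_def prod_eq_iff)
        then have "x \<in> A \<longleftrightarrow> (i, snd x) \<in> A"
          using closed Suc.prems grid_adj_commute by blast
        then show ?thesis using Suc.hyps(1)[of "(i, snd x)"] y by simp
      next
        case (Some l)
        then have "l = Some v" using f_seed[of x] Suc.prems by simp
        then show ?thesis using seed_D[of x v] Some by blast
      qed
    qed
    obtain y where y: "v \<in> V" "y \<in> B v" "y \<in> A" using A hit by blast
    have "B v \<subseteq> ?F"
      using B[OF y(1)] inside[OF y(1)] by (auto simp: grid_def inner_grid_def)
    then have "A \<inter> B v = B v"
      using conn[OF y(1), unfolded grid_connected_def, rule_format, of "A \<inter> B v"] closed y by blast
    then show "A = ?F" using A hit by blast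
  qed
  have "grid_labelling M f"
    unfolding grid_labelling_def
  proof (intro conjI ballI allI impI)
    fix x assume "x \<in> grid M - inner_grid M"
    then show "f x = None" using f_seed[of x None] by (auto simp: seed_def)
  next
    fix i j assume ij: "(Suc i, j) \<in> inner_grid M" "f (Suc i, j) = None"
    have "seed (Suc i, j) = None"
    proof (rule ccontr)
      assume "seed (Suc i, j) \<noteq> None"
      then obtain v where "seed (Suc i, j) = Some (Some v)"
        using ij(1) by (auto simp: seed_def split: if_splits)
      then show False using f_seed[of "(Suc i, j)" "Some v"] ij by (auto simp: grid_def inner_grid_def)
    qed
    then show "f (i, j) = None" using f_none[of "(Suc i, j)"] ij(2) by simp
  next
    fix v
    show "grid_connected {x \<in> grid M. f x = Some v}" by (rule fibre)
  qed
  then show ?thesis using B by blast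
qed

lemma doubleton_other: "{a, b} = {c, d} \<Longrightarrow> a = c \<Longrightarrow> b = d"
  by (metis doubleton_eq_iff)

lemma pair_graph_arcs:
  assumes "pair_graph G"
  shows "finite (pverts G)" "finite (parcs G)"
    and "(u, v) \<in> parcs G \<Longrightarrow> (v, u) \<in> parcs G"
    and "(u, v) \<in> parcs G \<Longrightarrow> u \<in> pverts G \<and> v \<in> pverts G \<and> u \<noteq> v"
proof -
  interpret pair_graph G by fact
  show "finite (pverts G)" "finite (parcs G)" by (rule pair_finite_verts pair_finite_arcs)+
  show "(u, v) \<in> parcs G \<Longrightarrow> (v, u) \<in> parcs G" by (rule arcs_symmetric)
  show "(u, v) \<in> parcs G \<Longrightarrow> u \<in> pverts G \<and> v \<in> pverts G \<and> u \<noteq> v"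
    using in_arcsD1 in_arcsD2 pair_no_loops[of "(u, v)"] by auto
qed

text \<open>
  Each edge is cut into thirds.  A vertex together with the adjacent outer thirds of its edges is a
  connected compact set \<open>X v\<close>.  These sets are pairwise disjoint, the middle thirds \<open>Q e\<close> are pairwise
  disjoint, and \<open>Q e\<close> meets only the sets of the two ends of \<open>e\<close>.  The set \<open>E\<close> contains one
  of the two orientations of each edge, the one in which its curve is traversed.
\<close>
lemma plane_drawing_pieces:
  fixes G :: "'a pair_pre_digraph"
  assumes "pair_graph G" and drawing: "plane_drawing G p \<gamma>"
  shows "\<exists>E X Q. E \<subseteq> parcs G \<and> (\<forall>(u, v)\<in>parcs G. (u, v) \<in> E \<or> (v, u) \<in> E) \<and>
    (\<forall>v\<in>pverts G. compact (X v) \<and> connected (X v) \<and> X v \<noteq> {}) \<and>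
    (\<forall>e\<in>E. compact (Q e) \<and> connected (Q e)) \<and>
    (\<forall>u\<in>pverts G. \<forall>v\<in>pverts G. u \<noteq> v \<longrightarrow> X u \<inter> X v = {}) \<and>
    (\<forall>(u, v)\<in>E. Q (u, v) \<inter> X u \<noteq> {} \<and> Q (u, v) \<inter> X v \<noteq> {} \<and>
       (\<forall>w\<in>pverts G. w \<noteq> u \<longrightarrow> w \<noteq> v \<longrightarrow> Q (u, v) \<inter> X w = {})) \<and>
    (\<forall>e\<in>E. \<forall>e'\<in>E. e \<noteq> e' \<longrightarrow> Q e \<inter> Q e' = ({} :: complex set))"
proof -
  have inj: "inj_on p (pverts G)"
    and edge: "\<And>u v. (u, v) \<in> parcs G \<Longrightarrow> arc (\<gamma> {u, v}) \<and>
        {pathstart (\<gamma> {u, v}), pathfinish (\<gamma> {u, v})} = {p u, p v} \<and>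
        path_image (\<gamma> {u, v}) \<inter> p ` pverts G = {p u, p v}"
    and cross: "\<And>u v x y. (u, v) \<in> parcs G \<Longrightarrow> (x, y) \<in> parcs G \<Longrightarrow> {u, v} \<noteq> {x, y} \<Longrightarrow>
        path_image (\<gamma> {u, v}) \<inter> path_image (\<gamma> {x, y}) \<subseteq> p ` ({u, v} \<inter> {x, y})"
    using drawing unfolding plane_drawing_def by blast+
  define E where "E = {(u, v) \<in> parcs G. pathstart (\<gamma> {u, v}) = p u}"
  define c where "c e t = \<gamma> {fst e, snd e} t" for e t
  have E: "(fst e, snd e) \<in> parcs G" "fst e \<in> pverts G" "snd e \<in> pverts G" "fst e \<noteq> snd e"
    if "e \<in> E" for e
    using that pair_graph_arcs(4)[OF assms(1)] by (auto simp: E_def)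
  have either: "(u, v) \<in> E \<or> (v, u) \<in> E" if uv: "(u, v) \<in> parcs G" for u v
  proof -
    have "(v, u) \<in> parcs G" using uv by (rule pair_graph_arcs(3)[OF assms(1)])
    moreover have "pathstart (\<gamma> {u, v}) = p u \<or> pathstart (\<gamma> {u, v}) = p v"
      using edge[OF uv] by blast
    ultimately show ?thesis using uv by (auto simp: E_def insert_commute)
  qed
  have ends: "c e 0 = p (fst e)" "c e 1 = p (snd e)" if e: "e \<in> E" for e
  proof -
    have *: "{c e 0, c e 1} = {p (fst e), p (snd e)}"
      using edge[OF E(1)[OF e]] by (simp add: c_def pathstart_def pathfinish_def)
    show "c e 0 = p (fst e)" using e by (auto simp: E_def c_def pathstart_def)
    with * show "c e 1 = p (snd e)" by (rule doubleton_other)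
  qed
  have cont: "continuous_on {0..1} (c e)" and c_inj: "inj_on (c e) {0..1}" if e: "e \<in> E" for e
    using edge[OF E(1)[OF e]] unfolding c_def[abs_def] by (simp_all add: arc_def path_def)
  have at_vertex: "w = fst e \<and> t = 0 \<or> w = snd e \<and> t = 1"
    if e: "e \<in> E" and w: "w \<in> pverts G" and t: "t \<in> {0..1}" and eq: "c e t = p w" for e w t
  proof -
    have "c e t \<in> path_image (\<gamma> {fst e, snd e})"
      using t by (simp add: c_def path_image_def)
    moreover have "c e t \<in> p ` pverts G" using w eq by simp
    ultimately have "p w \<in> {p (fst e), p (snd e)}" using edge[OF E(1)[OF e]] eq by auto
    then have "w = fst e \<or> w = snd e" using inj w E[OF e] by (auto dest: inj_onD)
    moreover have "t = 0" if "w = fst e"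
      by (rule inj_onD[OF c_inj[OF e]]) (use ends(1)[OF e] eq t that in auto)
    moreover have "t = 1" if "w = snd e"
      by (rule inj_onD[OF c_inj[OF e]]) (use ends(2)[OF e] eq t that in auto)
    ultimately show ?thesis by blast
  qed
  have meet: "\<exists>w. w \<in> pverts G \<and> c e s = p w"
    if "e \<in> E" "e' \<in> E" "e \<noteq> e'" "s \<in> {0..1}" "t \<in> {0..1}" "c e s = c e' t" for e e' s t
  proof -
    have "{fst e, snd e} \<noteq> {fst e', snd e'}"
    proof
      assume eq: "{fst e, snd e} = {fst e', snd e'}"
      then have "fst e = snd e'" using \<open>e \<noteq> e'\<close> by (metis doubleton_eq_iff prod_eq_iff)
      moreover have "p (fst e) = p (fst e')"
        using ends(1)[OF \<open>e \<in> E\<close>] ends(1)[OF \<open>e' \<in> E\<close>] eq by (simp add: c_def)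
      ultimately show False
        using E[OF \<open>e' \<in> E\<close>] inj by (metis inj_onD)
    qed
    then have "path_image (\<gamma> {fst e, snd e}) \<inter> path_image (\<gamma> {fst e', snd e'})
        \<subseteq> p ` ({fst e, snd e} \<inter> {fst e', snd e'})"
      by (rule cross[OF E(1)[OF \<open>e \<in> E\<close>] E(1)[OF \<open>e' \<in> E\<close>]])
    moreover have "c e s \<in> path_image (\<gamma> {fst e, snd e})"
      using \<open>s \<in> {0..1}\<close> by (simp add: c_def path_image_def)
    moreover have "c e' t \<in> path_image (\<gamma> {fst e', snd e'})"
      using \<open>t \<in> {0..1}\<close> by (simp add: c_def path_image_def)
    ultimately have "c e s \<in> p ` ({fst e, snd e} \<inter> {fst e', snd e'})"
      using \<open>c e s = c e' t\<close> by auto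
    then show ?thesis using E[OF \<open>e \<in> E\<close>] by auto
  qed
  define near where "near e w t \<longleftrightarrow> w = fst e \<and> t \<in> {0..1/3} \<or> w = snd e \<and> t \<in> {2/3..1::real}"
    for e :: "'a \<times> 'a" and w t
  define X where "X w = insert (p w) (\<Union>e\<in>E. c e ` {t. near e w t})" for w
  define Q where "Q e = c e ` {1/3..2/3}" for e
  have X: "z \<in> X w \<longleftrightarrow> z = p w \<or> (\<exists>e\<in>E. \<exists>t. near e w t \<and> z = c e t)" for z w
    unfolding X_def by blast
  have near_01: "t \<in> {0..1}" if "near e w t" for e w t
    using that by (auto simp: near_def)
  have p_in_X: "w = w'" if w: "p w' \<in> X w" "w \<in> pverts G" "w' \<in> pverts G" for w w'
  proof (cases "p w' = p w")
    case True
    then show ?thesis using inj w by (auto dest: inj_onD)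
  next
    case False
    then obtain e t where e: "e \<in> E" "near e w t" "p w' = c e t" using w(1) X by blast
    then show ?thesis
      using at_vertex[OF e(1) w(3) near_01[OF e(2)]] by (auto simp: near_def)
  qed
  have X_disj: "X u \<inter> X v = {}" if uv: "u \<in> pverts G" "v \<in> pverts G" "u \<noteq> v" for u v
  proof (rule ccontr)
    assume "X u \<inter> X v \<noteq> {}"
    then obtain z where z: "z \<in> X u" "z \<in> X v" by blast
    have no_vertex: False if "w \<in> pverts G" "z = p w" for w
      using p_in_X[where w = u and w' = w] p_in_X[where w = v and w' = w] z uv that by simp
    obtain e s where e: "e \<in> E" "near e u s" "z = c e s"
      using z(1) X no_vertex uv(1) by blast
    obtain e' t where e': "e' \<in> E" "near e' v t" "z = c e' t"
      using z(2) X no_vertex uv(2) by blast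
    have "e = e'"
    proof (rule ccontr)
      assume "e \<noteq> e'"
      then have "\<exists>w. w \<in> pverts G \<and> c e s = p w"
        by (rule meet[OF e(1) e'(1) _ near_01[OF e(2)] near_01[OF e'(2)]]) (use e(3) e'(3) in simp)
      then show False using no_vertex e(3) by auto
    qed
    moreover from this have "s = t"
      by (intro inj_onD[OF c_inj[OF e(1)]])
        (use e(3) e'(3) near_01[OF e(2)] near_01[OF e'(2)] in simp_all)
    ultimately show False using e(2) e'(2) uv(3) by (auto simp: near_def)
  qed
  have Q_vertex: "c e t \<noteq> p w" if "e \<in> E" "t \<in> {1/3..2/3}" "w \<in> pverts G" for e t w
    using at_vertex[of e w t] that by auto
  have Q_avoids: "Q e \<inter> X w = {}" if e: "e \<in> E" and w: "w \<in> pverts G" "w \<noteq> fst e" "w \<noteq> snd e" for e w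
  proof (rule ccontr)
    assume "Q e \<inter> X w \<noteq> {}"
    then obtain s where s: "s \<in> {1/3..2/3}" "c e s \<in> X w" unfolding Q_def by blast
    then obtain e' t where e': "e' \<in> E" "near e' w t" "c e s = c e' t"
      using X Q_vertex[OF e] w(1) by blast
    then have "e \<noteq> e'" using w by (auto simp: near_def)
    then show False
      using meet[OF e e'(1) _ _ near_01[OF e'(2)] e'(3)] Q_vertex[OF e s(1)] s(1) by auto
  qed
  have Q_disj: "Q e \<inter> Q e' = {}" if e: "e \<in> E" "e' \<in> E" "e \<noteq> e'" for e e'
  proof (rule ccontr)
    assume "Q e \<inter> Q e' \<noteq> {}"
    then obtain s t where st: "s \<in> {1/3..2/3}" "t \<in> {1/3..2/3}" "c e s = c e' t" unfolding Q_def by blast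
    then show False using meet[OF e _ _ st(3)] Q_vertex[OF e(1) st(1)] by auto
  qed
  have Q_meets: "Q e \<inter> X (fst e) \<noteq> {}" "Q e \<inter> X (snd e) \<noteq> {}" if e: "e \<in> E" for e
  proof -
    have "c e (1/3) \<in> Q e" "c e (2/3) \<in> Q e" unfolding Q_def by auto
    moreover have "near e (fst e) (1/3)" "near e (snd e) (2/3)" by (auto simp: near_def)
    then have "c e (1/3) \<in> X (fst e)" "c e (2/3) \<in> X (snd e)" using X e by blast+
    ultimately show "Q e \<inter> X (fst e) \<noteq> {}" "Q e \<inter> X (snd e) \<noteq> {}" by blast+
  qed
  have piece: "compact (c e ` {a..b})" "connected (c e ` {a..b})"
    if "e \<in> E" "0 \<le> a" "b \<le> 1" for e a b
  proof -
    have "continuous_on {a..b} (c e)" using cont[OF that(1)] by (rule continuous_on_subset) (use that in auto)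
    then show "compact (c e ` {a..b})" "connected (c e ` {a..b})"
      by (auto intro: compact_continuous_image connected_continuous_image)
  qed
  have finE: "finite E" using pair_graph_arcs(2)[OF assms(1)] by (rule finite_subset[rotated]) (auto simp: E_def)
  have near_piece: "compact (c e ` {t. near e w t})" "connected (c e ` {t. near e w t})"
    if "e \<in> E" for e w
  proof -
    have "{t. near e w t} = {0..1/3} \<or> {t. near e w t} = {2/3..1} \<or> {t. near e w t} = {}"
      using E(4)[OF that] unfolding near_def by auto
    then show "compact (c e ` {t. near e w t})" "connected (c e ` {t. near e w t})"
      using piece[OF that] by (elim disjE; simp)+
  qed
  have X_compact: "compact (X w)" for w
    unfolding X_def using finE near_piece by (intro compact_insert compact_UN) auto
  have X_connected: "connected (X w)" for w
  proof -
    have "X w = \<Union>((\<lambda>e. insert (p w) (c e ` {t. near e w t})) ` E \<union> {{p w}})"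
      unfolding X_def by auto
    also have "connected \<dots>"
    proof (rule connected_Union)
      fix T assume "T \<in> (\<lambda>e. insert (p w) (c e ` {t. near e w t})) ` E \<union> {{p w}}"
      then consider "T = {p w}" | e where "e \<in> E" "T = insert (p w) (c e ` {t. near e w t})" by blast
      then show "connected T"
      proof cases
        case 2
        show ?thesis
        proof (cases "w = fst e \<or> w = snd e")
          case True
          have "near e (fst e) 0" "near e (snd e) 1" by (auto simp: near_def)
          then have "p w \<in> c e ` {t. near e w t}"
            using True ends[OF 2(1)] by (metis image_eqI mem_Collect_eq)
          then show ?thesis using near_piece(2)[OF 2(1)] 2(2) by (simp add: insert_absorb)
        next
          case False
          then have "{t. near e w t} = {}" by (auto simp: near_def)
          then show ?thesis using 2(2) by simp
        qed
      qed simp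
    next
      show "\<Inter>((\<lambda>e. insert (p w) (c e ` {t. near e w t})) ` E \<union> {{p w}}) \<noteq> {}" by blast
    qed
    finally show ?thesis .
  qed
  show ?thesis
  proof (intro exI conjI)
    show "E \<subseteq> parcs G" by (auto simp: E_def)
    show "\<forall>(u, v)\<in>parcs G. (u, v) \<in> E \<or> (v, u) \<in> E" using either by blast
    show "\<forall>v\<in>pverts G. compact (X v) \<and> connected (X v) \<and> X v \<noteq> {}"
      using X_compact X_connected by (simp add: X_def)
    show "\<forall>e\<in>E. compact (Q e) \<and> connected (Q e)"
      unfolding Q_def using piece[of _ "1/3" "2/3"] by simp
    show "\<forall>u\<in>pverts G. \<forall>v\<in>pverts G. u \<noteq> v \<longrightarrow> X u \<inter> X v = {}" using X_disj by simp
    show "\<forall>(u, v)\<in>E. Q (u, v) \<inter> X u \<noteq> {} \<and> Q (u, v) \<inter> X v \<noteq> {} \<and>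
       (\<forall>w\<in>pverts G. w \<noteq> u \<longrightarrow> w \<noteq> v \<longrightarrow> Q (u, v) \<inter> X w = {})"
    proof (clarify, intro conjI ballI impI)
      fix u v assume uv: "(u, v) \<in> E"
      show "Q (u, v) \<inter> X u \<noteq> {}" "Q (u, v) \<inter> X v \<noteq> {}" using Q_meets[OF uv] by simp_all
      show "Q (u, v) \<inter> X w = {}" if "w \<in> pverts G" "w \<noteq> u" "w \<noteq> v" for w
        using Q_avoids[OF uv that(1)] that(2,3) by simp
    qed
    show "\<forall>e\<in>E. \<forall>e'\<in>E. e \<noteq> e' \<longrightarrow> Q e \<inter> Q e' = {}" using Q_disj by simp
  qed
qed

lemma cell_of_interior:
  assumes "N > 0" "cmod z + 1 \<le> real K"
  shows "cell_of N K z \<in> inner_grid (2 * N * K)"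
proof -
  have "0 < nat \<lfloor>real N * (x + real K)\<rfloor>" "nat \<lfloor>real N * (x + real K)\<rfloor> < 2 * N * K" if "\<bar>x\<bar> + 1 \<le> real K" for x
  proof -
    have "real N * 1 \<le> real N * (x + real K)" using that by (intro mult_left_mono) auto
    then have "1 \<le> real N * (x + real K)" using \<open>N > 0\<close> by linarith
    then show "0 < nat \<lfloor>real N * (x + real K)\<rfloor>" by simp
    have "real N * (x + real K) < real N * (2 * real K)"
      using that \<open>N > 0\<close> by (intro mult_strict_left_mono) auto
    then show "nat \<lfloor>real N * (x + real K)\<rfloor> < 2 * N * K"
      using \<open>1 \<le> real N * (x + real K)\<close> by (simp add: nat_less_iff floor_less_iff mult.commute mult.left_commute)
  qed
  then show ?thesis
    using assms(2) abs_Re_le_cmod[of z] abs_Im_le_cmod[of z]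
    by (auto simp: cell_of_def inner_grid_def)
qed

text \<open>
  A grid so fine that disjoint pieces of the drawing occupy disjoint sets of cells turns the pieces
  into regions and links.
\<close>
theorem planar_graph_grid_labelling:
  assumes "pair_graph G" "planar_graph G"
  shows "\<exists>M f. M > 0 \<and> grid_labelling M f \<and> (\<forall>v\<in>pverts G. \<exists>x\<in>grid M. f x = Some v) \<and>
    (\<forall>(u, v)\<in>parcs G. (Some u, Some v) \<in> contact M f)"
proof -
  let ?V = "pverts G"
  note arcs = pair_graph_arcs[OF assms(1)]
  obtain p \<gamma> where "plane_drawing G p \<gamma>" using assms(2) by (auto simp: planar_graph_def)
  from plane_drawing_pieces[OF assms(1) this] obtain E and X Q :: "_ \<Rightarrow> complex set"
    where E: "E \<subseteq> parcs G" and either: "\<forall>(u, v)\<in>parcs G. (u, v) \<in> E \<or> (v, u) \<in> E"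
      and X: "\<forall>v\<in>?V. compact (X v) \<and> connected (X v) \<and> X v \<noteq> {}"
      and Q: "\<forall>e\<in>E. compact (Q e) \<and> connected (Q e)"
      and X_disj: "\<forall>u\<in>?V. \<forall>v\<in>?V. u \<noteq> v \<longrightarrow> X u \<inter> X v = {}"
      and QX: "\<forall>(u, v)\<in>E. Q (u, v) \<inter> X u \<noteq> {} \<and> Q (u, v) \<inter> X v \<noteq> {} \<and>
        (\<forall>w\<in>?V. w \<noteq> u \<longrightarrow> w \<noteq> v \<longrightarrow> Q (u, v) \<inter> X w = {})"
      and Q_disj: "\<forall>e\<in>E. \<forall>e'\<in>E. e \<noteq> e' \<longrightarrow> Q e \<inter> Q e' = {}"
    by (elim exE conjE) (rule that)
  have finE: "finite E" using E arcs(2) by (rule finite_subset)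
  have "bounded (\<Union>(X ` ?V) \<union> \<Union>(Q ` E))"
    using X Q arcs(1) finE by (auto intro!: compact_imp_bounded)
  then obtain b where b: "\<And>z. z \<in> \<Union>(X ` ?V) \<union> \<Union>(Q ` E) \<Longrightarrow> cmod z \<le> b"
    unfolding bounded_iff by blast
  define K where "K = Suc (nat \<lceil>b\<rceil>)"
  have K: "cmod z + 1 \<le> real K" if "z \<in> \<Union>(X ` ?V) \<union> \<Union>(Q ` E)" for z
    using b[OF that] unfolding K_def by linarith
  have sep: "\<forall>\<^sub>F N in sequentially. S \<inter> T = {} \<longrightarrow> cell_of N K ` S \<inter> cell_of N K ` T = {}"
    if "S \<in> X ` ?V \<union> Q ` E" "T \<in> X ` ?V \<union> Q ` E" for S T
  proof (cases "S \<inter> T = {}")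
    case True
    have "compact S" "compact T" using that X Q by auto
    then have "\<forall>\<^sub>F N in sequentially. cell_of N K ` S \<inter> cell_of N K ` T = {}"
    proof (rule cell_of_separates[OF _ _ True])
      fix z assume "z \<in> S \<union> T"
      then have "z \<in> \<Union>(X ` ?V) \<union> \<Union>(Q ` E)" using that by blast
      then show "cmod z \<le> real K" using K by fastforce
    qed
    then show ?thesis by (rule eventually_mono) simp
  qed simp
  have "\<forall>\<^sub>F N in sequentially. N > 0 \<and> (\<forall>S\<in>X ` ?V \<union> Q ` E. \<forall>T\<in>X ` ?V \<union> Q ` E.
      S \<inter> T = {} \<longrightarrow> cell_of N K ` S \<inter> cell_of N K ` T = {})"
    using arcs(1) finE sep
    by (intro eventually_conj eventually_gt_at_top eventually_ball_finite ballI) auto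
  from eventually_happens'[OF sequentially_bot this] obtain N where "N > 0" and scale:
      "\<forall>S\<in>X ` ?V \<union> Q ` E. \<forall>T\<in>X ` ?V \<union> Q ` E. S \<inter> T = {} \<longrightarrow> cell_of N K ` S \<inter> cell_of N K ` T = {}"
    by (elim exE conjE)
  have N: "cell_of N K ` S \<inter> cell_of N K ` T = {}"
    if "S \<in> X ` ?V \<union> Q ` E" "T \<in> X ` ?V \<union> Q ` E" "S \<inter> T = {}" for S T
    using scale that by blast
  define M where "M = 2 * N * K"
  define B where "B v = cell_of N K ` X v" for v
  define L where "L e = cell_of N K ` Q e" for e
  have "\<exists>B'. (\<forall>v\<in>?V. grid_connected (B' v) \<and> B v \<subseteq> B' v \<and> B' v \<subseteq> B v \<union> \<Union>(L ` E)) \<and>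
    (\<forall>u\<in>?V. \<forall>v\<in>?V. u \<noteq> v \<longrightarrow> B' u \<inter> B' v = {}) \<and>
    (\<forall>(u, v)\<in>E. \<exists>x\<in>B' u. \<exists>y\<in>B' v. grid_adj x y)"
  proof (rule connect_along_links)
    show "grid_connected (B v)" if "v \<in> ?V" for v
      using X that unfolding B_def by (intro grid_connected_cell_of) blast
    show "grid_connected (L e)" if "e \<in> E" for e
      using Q that unfolding L_def by (intro grid_connected_cell_of) blast
    show "u \<in> ?V \<and> v \<in> ?V \<and> u \<noteq> v" if "(u, v) \<in> E" for u v
      using arcs(4) E that by blast
    show "B u \<inter> B v = {}" if "u \<in> ?V" "v \<in> ?V" "u \<noteq> v" for u v
      using N[of "X u" "X v"] X_disj that unfolding B_def by blast
    show "L e \<inter> L e' = {}" if "e \<in> E" "e' \<in> E" "e \<noteq> e'" for e e'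
      using N[of "Q e" "Q e'"] Q_disj that unfolding L_def by blast
    show "L (u, v) \<inter> B u \<noteq> {} \<and> L (u, v) \<inter> B v \<noteq> {}" if "(u, v) \<in> E" for u v
      using QX that unfolding L_def B_def by blast
    show "L (u, v) \<inter> B w = {}" if "(u, v) \<in> E" "w \<in> ?V" "w \<noteq> u" "w \<noteq> v" for u v w
      using N[of "Q (u, v)" "X w"] QX that unfolding L_def B_def by blast
  qed
  then obtain B' where grown:
      "\<forall>v\<in>?V. grid_connected (B' v) \<and> B v \<subseteq> B' v \<and> B' v \<subseteq> B v \<union> \<Union>(L ` E)"
      "\<forall>u\<in>?V. \<forall>v\<in>?V. u \<noteq> v \<longrightarrow> B' u \<inter> B' v = {}"
      "\<forall>(u, v)\<in>E. \<exists>x\<in>B' u. \<exists>y\<in>B' v. grid_adj x y"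
    by (elim exE conjE)
  have B': "grid_connected (B' v)" "B v \<subseteq> B' v" "B' v \<subseteq> B v \<union> \<Union>(L ` E)" if "v \<in> ?V" for v
    using grown(1) that by simp_all
  have touch: "\<exists>x\<in>B' u. \<exists>y\<in>B' v. grid_adj x y" if "(u, v) \<in> E" for u v
    using grown(3) that by blast
  have inside: "B' v \<subseteq> inner_grid M" if "v \<in> ?V" for v
  proof -
    have "cell_of N K ` (\<Union>(X ` ?V) \<union> \<Union>(Q ` E)) \<subseteq> inner_grid M"
      using cell_of_interior[OF \<open>N > 0\<close> K] unfolding M_def by blast
    then have "B v \<union> \<Union>(L ` E) \<subseteq> inner_grid M" using that unfolding B_def L_def by blast
    then show ?thesis using B'(3)[OF that] by (rule subset_trans[rotated])
  qed
  have "\<exists>f. grid_labelling M f \<and> (\<forall>v\<in>?V. \<forall>x\<in>B' v. f x = Some v)"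
    by (rule grid_labelling_of_regions) (use B'(1) inside grown(2) in simp_all)
  then obtain f where f: "grid_labelling M f" "\<forall>v\<in>?V. \<forall>x\<in>B' v. f x = Some v"
    by (elim exE conjE)
  have f_B: "f x = Some v" if "v \<in> ?V" "x \<in> B' v" for v x using f(2) that by simp
  have grid: "x \<in> grid M" if "v \<in> ?V" "x \<in> B' v" for v x
    using inside[OF that(1)] that(2) by (auto simp: grid_def inner_grid_def)
  have contact_E: "(Some u, Some v) \<in> contact M f" if uv: "(u, v) \<in> E" for u v
  proof -
    obtain x y where xy: "x \<in> B' u" "y \<in> B' v" "grid_adj x y" using touch[OF uv] by blast
    have V: "u \<in> ?V" "v \<in> ?V" using arcs(4) E uv by blast+
    have "(f x, f y) \<in> contact M f" using grid V xy by (intro contactI) blast+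
    then show ?thesis using f_B[OF V(1) xy(1)] f_B[OF V(2) xy(2)] by simp
  qed
  have "(Some u, Some v) \<in> contact M f" if uv: "(u, v) \<in> parcs G" for u v
    using either uv contact_E[of u v] contact_sym[OF contact_E[of v u]] by blast
  moreover have "\<exists>x\<in>grid M. f x = Some v" if v: "v \<in> ?V" for v
  proof -
    obtain x where "x \<in> B v" using X v unfolding B_def by blast
    then have "x \<in> B' v" using B'(2)[OF v] by blast
    then show ?thesis using grid[OF v] f_B[OF v] by blast
  qed
  moreover have "M > 0" using \<open>N > 0\<close> by (simp add: M_def K_def)
  ultimately show ?thesis using f(1) by blast
qed

section \<open>Planar graphs\<close>

theorem theorem1:
  fixes G :: "'a pair_pre_digraph" and n :: nat
  assumes "pair_graph G"
    and "pverts G \<noteq> {}"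
    and "planar_graph G"
    and "n = card (pverts G)"
  shows "real (nonrep_chromatic_number G) \<le> 8 * (1 + log (3/2) (real n))"
proof -
  obtain M f where "M > 0" and f: "grid_labelling M f"
    and onto: "\<forall>v\<in>pverts G. \<exists>x\<in>grid M. f x = Some v"
    and edges: "\<forall>(u, v)\<in>parcs G. (Some u, Some v) \<in> contact M f"
    using planar_graph_grid_labelling[OF assms(1,3)] by (elim exE conjE)
  have "\<exists>layer. has_layered_separators (parcs G) (pverts G) layer"
    by (rule grid_labelling_separators[OF f \<open>M > 0\<close> pair_graph_arcs(1)[OF assms(1)]])
      (use onto edges pair_graph_arcs(4)[OF assms(1)] in blast)+
  then obtain layer where "has_layered_separators (parcs G) (pverts G) layer" ..
  from nonrepetitive_of_layered_separators[OF assms(1,2) this] obtain k \<psi>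
    where "k_colouring G k \<psi>" "nonrepetitive G \<psi>"
      and k: "real k \<le> 8 * (1 + log (3/2) (real (card (pverts G))))"
    by (elim exE conjE)
  then have "nonrep_chromatic_number G \<le> k"
    unfolding nonrep_chromatic_number_def by (intro Least_le) blast
  then have "real (nonrep_chromatic_number G) \<le> real k" by simp
  also note k
  finally show ?thesis using assms(4) by simp
qed

end
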